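(* The topology $\kappa(\mathcal{M}^1,\mathcal{C}_0)$ on the space $\mathcal{M}^1$ is generated by the seminorms $$\mathcal{M}^1\to\mathbb{R}_+,\quad\mu\mapsto p_{g,h}(\mu):=\|h*(g\mu)\|_1,\qquad g\in\mathcal{C}_0,\ h\in L^1.$$
   Context: $\mathcal{C}_0$ is the Banach space (sup norm) of continuous complex-valued functions on $\mathbb{R}^n$ vanishing at infinity, and $\mathcal{M}^1$ is its strong dual, the space of integrable (i.e. bounded, finite complex Radon) measures on $\mathbb{R}^n$, with norm $\|\mu\|_1=\sup\{|\langle\varphi,\mu\rangle|:\varphi\in\mathcal{C}_0,\ \|\varphi\|_\infty\le1\}$. $L^1=L^1(\mathbb{R}^n)$, $g\mu$ is the product of a function and a measure, and $*$ is convolution. $\kappa(E,F)$ denotes the topology on $E$ of uniform convergence on absolutely convex compact subsets of $F$. The space $\mathcal{M}^1$ with $\kappa(\mathcal{M}^1,\mathcal{C}_0)$ is denoted $\mathcal{M}^1_c$. *)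

theory Defs
  imports "HOL-Analysis.Analysis"
begin

section \<open>Complex normed spaces and their duals\<close>

class complex_normed_vector = real_normed_vector +
  fixes scaleC :: "complex \<Rightarrow> 'a \<Rightarrow> 'a"  (infixr \<open>*\<^sub>C\<close> 75)
  assumes scaleC_add_right: "a *\<^sub>C (x + y) = a *\<^sub>C x + a *\<^sub>C y"
    and scaleC_add_left: "(a + b) *\<^sub>C x = a *\<^sub>C x + b *\<^sub>C x"
    and scaleC_scaleC: "a *\<^sub>C (b *\<^sub>C x) = (a * b) *\<^sub>C x"
    and scaleR_scaleC: "r *\<^sub>R x = complex_of_real r *\<^sub>C x"
    and norm_scaleC: "norm (a *\<^sub>C x) = cmod a * norm x"

definition absolutely_convex :: "'a::complex_normed_vector set \<Rightarrow> bool" where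
  "absolutely_convex K \<longleftrightarrow>
     (\<forall>x\<in>K. \<forall>y\<in>K. \<forall>a b. cmod a + cmod b \<le> 1 \<longrightarrow> a *\<^sub>C x + b *\<^sub>C y \<in> K)"

definition seminorm :: "('a::complex_normed_vector \<Rightarrow> real) \<Rightarrow> bool" where
  "seminorm p \<longleftrightarrow>
     (\<forall>x. 0 \<le> p x) \<and> (\<forall>x y. p (x + y) \<le> p x + p y) \<and> (\<forall>a x. p (a *\<^sub>C x) = cmod a * p x)"

text \<open>The open balls of the individual seminorms form a subbasis; \<^const>\<open>UNIV\<close> is
  inserted so that the carrier is the whole space even if \<open>P\<close> is empty.\<close>

definition seminorm_topology :: "('a::complex_normed_vector \<Rightarrow> real) set \<Rightarrow> 'a topology" where
  "seminorm_topology P =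
     topology_generated_by (insert UNIV {{y. p (y - x) < e} | p x e. p \<in> P \<and> 0 < e})"

typedef (overloaded) 'a cdual =
  "{\<mu> :: 'a::complex_normed_vector \<Rightarrow> complex.
      bounded_linear \<mu> \<and> (\<forall>c x. \<mu> (c *\<^sub>C x) = c * \<mu> x)}"
  morphisms Rep_cdual Abs_cdual
  by (rule exI[of _ "\<lambda>_. 0"]) simp

definition pairing :: "'a::complex_normed_vector \<Rightarrow> 'a cdual \<Rightarrow> complex"  (\<open>\<langle>_, _\<rangle>\<close>) where
  "\<langle>x, \<mu>\<rangle> = Rep_cdual \<mu> x"

lemma cdual_eqI: "(\<And>x. \<langle>x, \<mu>\<rangle> = \<langle>x, \<nu>\<rangle>) \<Longrightarrow> \<mu> = \<nu>"
  by (simp add: pairing_def Rep_cdual_inject[symmetric] fun_eq_iff)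

lemma bounded_linear_pairing: "bounded_linear (\<lambda>x. \<langle>x, \<mu>\<rangle>)"
  and pairing_scaleC_left: "\<langle>c *\<^sub>C x, \<mu>\<rangle> = c * \<langle>x, \<mu>\<rangle>"
  using Rep_cdual[of \<mu>] by (simp_all add: pairing_def)

lemma pairing_add_left: "\<langle>x + y, \<mu>\<rangle> = \<langle>x, \<mu>\<rangle> + \<langle>y, \<mu>\<rangle>"
  and pairing_scaleR_left: "\<langle>r *\<^sub>R x, \<mu>\<rangle> = r *\<^sub>R \<langle>x, \<mu>\<rangle>"
  and pairing_zero_left: "\<langle>0, \<mu>\<rangle> = 0"
proof -
  interpret bounded_linear "\<lambda>x. \<langle>x, \<mu>\<rangle>" by (rule bounded_linear_pairing)
  show "\<langle>x + y, \<mu>\<rangle> = \<langle>x, \<mu>\<rangle> + \<langle>y, \<mu>\<rangle>" "\<langle>r *\<^sub>R x, \<mu>\<rangle> = r *\<^sub>R \<langle>x, \<mu>\<rangle>" "\<langle>0, \<mu>\<rangle> = 0"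
    by (rule add scaleR zero)+
qed

lemma pairing_Abs:
  assumes "bounded_linear f" "\<And>c x. f (c *\<^sub>C x) = c * f x"
  shows "\<langle>x, Abs_cdual f\<rangle> = f x"
  using assms by (simp add: pairing_def Abs_cdual_inverse)

instantiation cdual :: (complex_normed_vector) complex_normed_vector
begin

definition zero_cdual :: "'a cdual" where "zero_cdual = Abs_cdual (\<lambda>x. 0)"
definition plus_cdual :: "'a cdual \<Rightarrow> 'a cdual \<Rightarrow> 'a cdual"
  where "plus_cdual \<mu> \<nu> = Abs_cdual (\<lambda>x. \<langle>x, \<mu>\<rangle> + \<langle>x, \<nu>\<rangle>)"
definition minus_cdual :: "'a cdual \<Rightarrow> 'a cdual \<Rightarrow> 'a cdual"
  where "minus_cdual \<mu> \<nu> = Abs_cdual (\<lambda>x. \<langle>x, \<mu>\<rangle> - \<langle>x, \<nu>\<rangle>)"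
definition uminus_cdual :: "'a cdual \<Rightarrow> 'a cdual"
  where "uminus_cdual \<mu> = Abs_cdual (\<lambda>x. - \<langle>x, \<mu>\<rangle>)"
definition scaleC_cdual :: "complex \<Rightarrow> 'a cdual \<Rightarrow> 'a cdual"
  where "scaleC_cdual c \<mu> = Abs_cdual (\<lambda>x. c * \<langle>x, \<mu>\<rangle>)"
definition scaleR_cdual :: "real \<Rightarrow> 'a cdual \<Rightarrow> 'a cdual"
  where "scaleR_cdual r \<mu> = complex_of_real r *\<^sub>C \<mu>"
definition norm_cdual :: "'a cdual \<Rightarrow> real"
  where "norm_cdual \<mu> = (SUP x\<in>{x. norm x \<le> 1}. cmod \<langle>x, \<mu>\<rangle>)"
definition dist_cdual :: "'a cdual \<Rightarrow> 'a cdual \<Rightarrow> real"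
  where "dist_cdual \<mu> \<nu> = norm (\<mu> - \<nu>)"
definition sgn_cdual :: "'a cdual \<Rightarrow> 'a cdual"
  where "sgn_cdual \<mu> = inverse (norm \<mu>) *\<^sub>R \<mu>"
definition uniformity_cdual :: "('a cdual \<times> 'a cdual) filter"
  where "uniformity_cdual = (INF e\<in>{0<..}. principal {(x, y). dist x y < e})"
definition open_cdual :: "'a cdual set \<Rightarrow> bool"
  where "open_cdual U \<longleftrightarrow> (\<forall>x\<in>U. \<forall>\<^sub>F (x', y) in uniformity. x' = x \<longrightarrow> y \<in> U)"

lemma pairing_ops:
  "\<langle>x, 0\<rangle> = 0" "\<langle>x, \<mu> + \<nu>\<rangle> = \<langle>x, \<mu>\<rangle> + \<langle>x, \<nu>\<rangle>" "\<langle>x, \<mu> - \<nu>\<rangle> = \<langle>x, \<mu>\<rangle> - \<langle>x, \<nu>\<rangle>"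
  "\<langle>x, - \<mu>\<rangle> = - \<langle>x, \<mu>\<rangle>" "\<langle>x, c *\<^sub>C \<mu>\<rangle> = c * \<langle>x, \<mu>\<rangle>"
  "\<langle>x, r *\<^sub>R \<mu>\<rangle> = complex_of_real r * \<langle>x, \<mu>\<rangle>"
  unfolding zero_cdual_def plus_cdual_def minus_cdual_def uminus_cdual_def
    scaleC_cdual_def scaleR_cdual_def
  by (subst pairing_Abs;
      auto intro!: bounded_linear_intros bounded_linear_pairing bounded_linear_minus
        simp: pairing_scaleC_left algebra_simps)+

lemma bdd_above_pairing:
  fixes \<mu> :: "'a cdual"
  shows "bdd_above ((\<lambda>x. cmod \<langle>x, \<mu>\<rangle>) ` {x. norm x \<le> 1})"
proof -
  obtain B where "0 < B" and B: "\<And>x. cmod \<langle>x, \<mu>\<rangle> \<le> norm x * B"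
    using bounded_linear.pos_bounded[OF bounded_linear_pairing] by blast
  show ?thesis
  proof (rule bdd_aboveI2)
    fix x :: 'a assume "x \<in> {x. norm x \<le> 1}"
    then have "norm x * B \<le> 1 * B" using \<open>0 < B\<close> by (intro mult_right_mono) auto
    with B[of x] show "cmod \<langle>x, \<mu>\<rangle> \<le> B" by simp
  qed
qed

lemma cmod_pairing_le_norm: "norm x \<le> 1 \<Longrightarrow> cmod \<langle>x, \<mu>\<rangle> \<le> norm \<mu>"
  unfolding norm_cdual_def by (rule cSUP_upper[OF _ bdd_above_pairing]) simp

lemma norm_cdual_le: "(\<And>x. norm x \<le> 1 \<Longrightarrow> cmod \<langle>x, \<mu>\<rangle> \<le> b) \<Longrightarrow> norm \<mu> \<le> b"
  unfolding norm_cdual_def by (rule cSUP_least) (auto intro: exI[of _ 0])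

lemma norm_cdual_nonneg: "0 \<le> norm (\<mu> :: 'a cdual)"
  using cmod_pairing_le_norm[of 0 \<mu>] by (simp add: pairing_zero_left)

lemma norm_scaleC_cdual_le: "norm (c *\<^sub>C \<mu>) \<le> cmod c * norm (\<mu> :: 'a cdual)"
  by (rule norm_cdual_le)
    (auto simp: pairing_ops norm_mult intro!: mult_left_mono cmod_pairing_le_norm)

instance
proof
  fix \<mu> \<nu> \<xi> :: "'a cdual" and a b :: complex and r s :: real
  show "\<mu> + \<nu> + \<xi> = \<mu> + (\<nu> + \<xi>)" "\<mu> + \<nu> = \<nu> + \<mu>" "0 + \<mu> = \<mu>" "- \<mu> + \<mu> = 0" "\<mu> - \<nu> = \<mu> + - \<nu>"
    "r *\<^sub>R (\<mu> + \<nu>) = r *\<^sub>R \<mu> + r *\<^sub>R \<nu>" "(r + s) *\<^sub>R \<mu> = r *\<^sub>R \<mu> + s *\<^sub>R \<mu>"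
    "r *\<^sub>R s *\<^sub>R \<mu> = (r * s) *\<^sub>R \<mu>" "1 *\<^sub>R \<mu> = \<mu>"
    "a *\<^sub>C (\<mu> + \<nu>) = a *\<^sub>C \<mu> + a *\<^sub>C \<nu>" "(a + b) *\<^sub>C \<mu> = a *\<^sub>C \<mu> + b *\<^sub>C \<mu>"
    "a *\<^sub>C (b *\<^sub>C \<mu>) = (a * b) *\<^sub>C \<mu>"
    by (rule cdual_eqI; simp add: pairing_ops algebra_simps)+
  show scR: "r *\<^sub>R \<mu> = complex_of_real r *\<^sub>C \<mu>" for r and \<mu> :: "'a cdual"
    by (rule scaleR_cdual_def)
  show "dist \<mu> \<nu> = norm (\<mu> - \<nu>)" by (rule dist_cdual_def)
  show "sgn \<mu> = inverse (norm \<mu>) *\<^sub>R \<mu>" by (rule sgn_cdual_def)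
  show "uniformity = (INF e\<in>{0<..}. principal {(x :: 'a cdual, y). dist x y < e})"
    by (rule uniformity_cdual_def)
  show "open U \<longleftrightarrow> (\<forall>x\<in>U. \<forall>\<^sub>F (x', y) in uniformity. x' = x \<longrightarrow> y \<in> U)" for U :: "'a cdual set"
    by (rule open_cdual_def)
  show "norm (\<mu> + \<nu>) \<le> norm \<mu> + norm \<nu>"
    by (rule norm_cdual_le)
      (auto simp: pairing_ops intro!: norm_triangle_le add_mono cmod_pairing_le_norm)
  show *: "norm (a *\<^sub>C \<mu>) = cmod a * norm \<mu>" for a and \<mu> :: "'a cdual"
  proof (cases "a = 0")
    case True
    with norm_scaleC_cdual_le[of a \<mu>] norm_cdual_nonneg[of "a *\<^sub>C \<mu>"] show ?thesis by simp
  next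
    case False
    have "\<mu> = inverse a *\<^sub>C (a *\<^sub>C \<mu>)"
      using False by (intro cdual_eqI) (simp add: pairing_ops)
    with norm_scaleC_cdual_le[of "inverse a" "a *\<^sub>C \<mu>"]
    have "norm \<mu> \<le> inverse (cmod a) * norm (a *\<^sub>C \<mu>)" by (simp add: norm_inverse)
    with False have "cmod a * norm \<mu> \<le> norm (a *\<^sub>C \<mu>)" by (simp add: field_simps)
    with norm_scaleC_cdual_le[of a \<mu>] show ?thesis by simp
  qed
  show "norm (r *\<^sub>R \<mu>) = \<bar>r\<bar> * norm \<mu>" by (simp add: scR *)
  show "norm \<mu> = 0 \<longleftrightarrow> \<mu> = 0"
  proof
    assume 0: "norm \<mu> = 0"
    show "\<mu> = 0"
    proof (rule cdual_eqI)
      fix x :: 'a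
      have "\<langle>x /\<^sub>R norm x, \<mu>\<rangle> = 0"
        using cmod_pairing_le_norm[of "x /\<^sub>R norm x" \<mu>] 0 by (cases "x = 0") auto
      then show "\<langle>x, \<mu>\<rangle> = \<langle>x, 0\<rangle>"
        by (cases "x = 0") (auto simp: pairing_scaleR_left pairing_ops pairing_zero_left)
    qed
  next
    assume "\<mu> = 0"
    then show "norm \<mu> = 0"
      using norm_cdual_le[of \<mu> 0] norm_cdual_nonneg[of \<mu>] by (simp add: pairing_ops)
  qed
qed

end

text \<open>The topology \<open>\<kappa>(E', E)\<close> of uniform convergence on the absolutely convex, norm-compact
  subsets of \<open>E\<close>. Since \<open>\<langle>_, \<nu> - \<mu>\<rangle>\<close> attains its maximum modulus on a (nonempty) compact set, the
  subbasic sets below are the open balls of the seminorms \<open>\<mu> \<mapsto> sup {|\<langle>x, \<mu>\<rangle>| : x \<in> K}\<close>.\<close>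

definition kappa :: "'a::complex_normed_vector cdual topology" where
  "kappa = topology_generated_by
     {{\<nu>. \<forall>x\<in>K. cmod (\<langle>x, \<nu>\<rangle> - \<langle>x, \<mu>\<rangle>) < e} | K \<mu> e. compact K \<and> absolutely_convex K \<and> 0 < e}"


section \<open>Continuous functions vanishing at infinity\<close>

typedef (overloaded) 'n c0 =
  "{f :: real^'n::finite \<Rightarrow> complex. continuous_on UNIV f \<and> (f \<longlongrightarrow> 0) at_infinity}"
  morphisms apply_c0 Abs_c0
  by (rule exI[of _ "\<lambda>_. 0"]) simp

declare [[coercion "apply_c0 :: 'n::finite c0 \<Rightarrow> real^'n \<Rightarrow> complex"]]

lemma c0_eqI: "(\<And>x. f x = g x) \<Longrightarrow> f = g" for f g :: "'n::finite c0"
  by (simp add: apply_c0_inject[symmetric] fun_eq_iff)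

lemma continuous_on_c0 [continuous_intros]: "continuous_on A (apply_c0 f)"
  and tendsto_c0 [tendsto_intros]: "(apply_c0 f \<longlongrightarrow> 0) at_infinity"
  using apply_c0[of f] by (auto intro: continuous_on_subset)

lemma apply_Abs_c0:
  "continuous_on UNIV f \<Longrightarrow> (f \<longlongrightarrow> 0) at_infinity \<Longrightarrow> apply_c0 (Abs_c0 f) = f"
  by (simp add: Abs_c0_inverse)

lemma bounded_range_c0: "bounded (range (apply_c0 f))"
proof -
  have "\<forall>\<^sub>F x in at_infinity. cmod (f x) < 1"
    using tendstoD[OF tendsto_c0[of f], of 1] by simp
  then obtain b where b: "\<And>x. b \<le> norm x \<Longrightarrow> cmod (f x) < 1"
    by (auto simp: eventually_at_infinity)
  have "bounded (apply_c0 f ` cball 0 b)"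
    by (intro compact_imp_bounded compact_continuous_image continuous_on_c0) simp
  moreover have "bounded (apply_c0 f ` (- cball 0 b))"
    by (rule boundedI[of _ 1]) (use b in \<open>auto simp: not_le intro!: less_imp_le\<close>)
  ultimately have "bounded (apply_c0 f ` cball 0 b \<union> apply_c0 f ` (- cball 0 b))" by simp
  then show ?thesis by (simp add: image_Un[symmetric] Compl_partition)
qed

instantiation c0 :: (finite) complex_normed_vector
begin

definition zero_c0 :: "'a c0" where "zero_c0 = Abs_c0 (\<lambda>x. 0)"
definition plus_c0 :: "'a c0 \<Rightarrow> 'a c0 \<Rightarrow> 'a c0"
  where "plus_c0 f g = Abs_c0 (\<lambda>x. f x + g x)"
definition minus_c0 :: "'a c0 \<Rightarrow> 'a c0 \<Rightarrow> 'a c0"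
  where "minus_c0 f g = Abs_c0 (\<lambda>x. f x - g x)"
definition uminus_c0 :: "'a c0 \<Rightarrow> 'a c0"
  where "uminus_c0 f = Abs_c0 (\<lambda>x. - f x)"
definition scaleC_c0 :: "complex \<Rightarrow> 'a c0 \<Rightarrow> 'a c0"
  where "scaleC_c0 c f = Abs_c0 (\<lambda>x. c * f x)"
definition scaleR_c0 :: "real \<Rightarrow> 'a c0 \<Rightarrow> 'a c0"
  where "scaleR_c0 r f = complex_of_real r *\<^sub>C f"
definition norm_c0 :: "'a c0 \<Rightarrow> real"
  where "norm_c0 f = (SUP x. cmod (f x))"
definition dist_c0 :: "'a c0 \<Rightarrow> 'a c0 \<Rightarrow> real"
  where "dist_c0 f g = norm (f - g)"
definition sgn_c0 :: "'a c0 \<Rightarrow> 'a c0"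
  where "sgn_c0 f = inverse (norm f) *\<^sub>R f"
definition uniformity_c0 :: "('a c0 \<times> 'a c0) filter"
  where "uniformity_c0 = (INF e\<in>{0<..}. principal {(x, y). dist x y < e})"
definition open_c0 :: "'a c0 set \<Rightarrow> bool"
  where "open_c0 U \<longleftrightarrow> (\<forall>x\<in>U. \<forall>\<^sub>F (x', y) in uniformity. x' = x \<longrightarrow> y \<in> U)"

lemma apply_c0_ops:
  fixes f g :: "'a c0"
  shows "apply_c0 (0 :: 'a c0) x = 0" "(f + g) x = f x + g x" "(f - g) x = f x - g x"
    "(- f) x = - f x" "(c *\<^sub>C f) x = c * f x" "(r *\<^sub>R f) x = complex_of_real r * f x"
  unfolding zero_c0_def plus_c0_def minus_c0_def uminus_c0_def scaleC_c0_def scaleR_c0_def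
  by (subst apply_Abs_c0;
      auto intro!: continuous_intros tendsto_eq_intros tendsto_c0)+

lemma cmod_le_norm_c0: "cmod (apply_c0 f x) \<le> norm f"
  unfolding norm_c0_def
  using bounded_range_c0[of f]
  by (intro cSUP_upper bounded_imp_bdd_above) (auto simp: bounded_norm_comp)

lemma norm_c0_le: "(\<And>x. cmod (apply_c0 f x) \<le> b) \<Longrightarrow> norm f \<le> b"
  unfolding norm_c0_def by (rule cSUP_least) auto

lemma norm_c0_nonneg: "0 \<le> norm (f :: 'a c0)"
  using cmod_le_norm_c0[of f 0] norm_ge_zero order_trans by blast

lemma norm_scaleC_c0_le: "norm (c *\<^sub>C f) \<le> cmod c * norm (f :: 'a c0)"
  by (rule norm_c0_le) (auto simp: apply_c0_ops norm_mult intro!: mult_left_mono cmod_le_norm_c0)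

instance
proof
  fix f g h :: "'a c0" and a b :: complex and r s :: real
  show "f + g + h = f + (g + h)" "f + g = g + f" "0 + f = f" "- f + f = 0" "f - g = f + - g"
    "r *\<^sub>R (f + g) = r *\<^sub>R f + r *\<^sub>R g" "(r + s) *\<^sub>R f = r *\<^sub>R f + s *\<^sub>R f"
    "r *\<^sub>R s *\<^sub>R f = (r * s) *\<^sub>R f" "1 *\<^sub>R f = f"
    "a *\<^sub>C (f + g) = a *\<^sub>C f + a *\<^sub>C g" "(a + b) *\<^sub>C f = a *\<^sub>C f + b *\<^sub>C f"
    "a *\<^sub>C (b *\<^sub>C f) = (a * b) *\<^sub>C f"
    by (rule c0_eqI; simp add: apply_c0_ops algebra_simps)+
  show scR: "r *\<^sub>R f = complex_of_real r *\<^sub>C f" for r and f :: "'a c0"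
    by (rule scaleR_c0_def)
  show "dist f g = norm (f - g)" by (rule dist_c0_def)
  show "sgn f = inverse (norm f) *\<^sub>R f" by (rule sgn_c0_def)
  show "uniformity = (INF e\<in>{0<..}. principal {(x :: 'a c0, y). dist x y < e})"
    by (rule uniformity_c0_def)
  show "open U \<longleftrightarrow> (\<forall>x\<in>U. \<forall>\<^sub>F (x', y) in uniformity. x' = x \<longrightarrow> y \<in> U)" for U :: "'a c0 set"
    by (rule open_c0_def)
  show "norm (f + g) \<le> norm f + norm g"
    by (rule norm_c0_le)
      (auto simp: apply_c0_ops intro!: norm_triangle_le add_mono cmod_le_norm_c0)
  show *: "norm (a *\<^sub>C f) = cmod a * norm f" for a and f :: "'a c0"
  proof (cases "a = 0")
    case True
    with norm_scaleC_c0_le[of a f] norm_c0_nonneg[of "a *\<^sub>C f"] show ?thesis by simp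
  next
    case False
    have "f = inverse a *\<^sub>C (a *\<^sub>C f)"
      using False by (intro c0_eqI) (simp add: apply_c0_ops)
    with norm_scaleC_c0_le[of "inverse a" "a *\<^sub>C f"]
    have "norm f \<le> inverse (cmod a) * norm (a *\<^sub>C f)" by (simp add: norm_inverse)
    with False have "cmod a * norm f \<le> norm (a *\<^sub>C f)" by (simp add: field_simps)
    with norm_scaleC_c0_le[of a f] show ?thesis by simp
  qed
  show "norm (r *\<^sub>R f) = \<bar>r\<bar> * norm f" by (simp add: scR *)
  show "norm f = 0 \<longleftrightarrow> f = 0"
  proof
    assume "norm f = 0"
    then show "f = 0"
      using cmod_le_norm_c0[of f] by (intro c0_eqI) (simp add: apply_c0_ops)
  next
    assume "f = 0"
    then show "norm f = 0"
      using norm_c0_le[of f 0] norm_c0_nonneg[of f] by (simp add: apply_c0_ops)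
  qed
qed

end

instantiation c0 :: (finite) times
begin

definition times_c0 :: "'a c0 \<Rightarrow> 'a c0 \<Rightarrow> 'a c0"
  where "times_c0 f g = Abs_c0 (\<lambda>x. f x * g x)"

instance ..

end

lemma apply_c0_times: "(f * g) x = f x * g x" for f g :: "'n::finite c0"
  unfolding times_c0_def
  by (subst apply_Abs_c0) (auto intro!: continuous_intros tendsto_eq_intros tendsto_c0)

instance c0 :: (finite) banach
proof
  fix X :: "nat \<Rightarrow> 'a c0"
  assume "Cauchy X"
  have "\<exists>N. \<forall>m\<ge>N. \<forall>n\<ge>N. \<forall>x. dist (X m x) (X n x) < e" if "0 < e" for e
  proof -
    from \<open>Cauchy X\<close> that obtain N where N: "\<And>m n. m \<ge> N \<Longrightarrow> n \<ge> N \<Longrightarrow> dist (X m) (X n) < e"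
      unfolding Cauchy_def by blast
    have "dist (X m x) (X n x) < e" if "m \<ge> N" "n \<ge> N" for m n x
      using cmod_le_norm_c0[of "X m - X n" x] N[OF that]
      by (simp add: dist_norm apply_c0_ops)
    then show ?thesis by blast
  qed
  then obtain f where f: "uniform_limit UNIV (\<lambda>n. apply_c0 (X n)) f sequentially"
    using uniformly_convergent_eq_cauchy[of "\<lambda>_. True" "\<lambda>n. apply_c0 (X n)"]
    unfolding uniform_limit_sequentially_iff by metis
  have "continuous_on UNIV f"
    by (rule uniform_limit_theorem[OF always_eventually f]) (simp_all add: continuous_on_c0)
  moreover have "(f \<longlongrightarrow> 0) at_infinity"
  proof (rule tendstoI)
    fix e :: real assume "0 < e"
    then have "\<forall>\<^sub>F n in sequentially. \<forall>x\<in>UNIV. dist (X n x) (f x) < e/2"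
      by (intro uniform_limitD[OF f]) simp
    then obtain n where n: "\<And>x. dist (X n x) (f x) < e/2"
      by (auto simp: eventually_sequentially)
    have "\<forall>\<^sub>F x in at_infinity. dist (X n x) 0 < e/2"
      by (rule tendstoD[OF tendsto_c0]) (use \<open>0 < e\<close> in simp)
    then show "\<forall>\<^sub>F x in at_infinity. dist (f x) 0 < e"
      by eventually_elim (use n in \<open>metis dist_commute dist_triangle_half_r\<close>)
  qed
  ultimately have f': "apply_c0 (Abs_c0 f) = f" by (rule apply_Abs_c0)
  have "X \<longlonglongrightarrow> Abs_c0 f"
  proof (rule tendstoI)
    fix e :: real assume "0 < e"
    then have "\<forall>\<^sub>F n in sequentially. \<forall>x\<in>UNIV. dist (X n x) (f x) < e/2"
      by (intro uniform_limitD[OF f]) simp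
    then show "\<forall>\<^sub>F n in sequentially. dist (X n) (Abs_c0 f) < e"
    proof eventually_elim
      case (elim n)
      then have "norm (X n - Abs_c0 f) \<le> e/2"
        by (intro norm_c0_le) (auto simp: apply_c0_ops f' dist_norm intro: less_imp_le)
      with \<open>0 < e\<close> show ?case by (simp add: dist_norm)
    qed
  qed
  then show "convergent X" by (rule convergentI)
qed


section \<open>Integrable measures\<close>

text \<open>Integrable measures are represented as bounded functionals on \<open>C\<^sub>0\<close>, so that
  \<open>\<langle>\<phi>, \<mu>\<rangle> = \<integral> \<phi> d\<mu>\<close>, and the product with a function and the convolution are defined by
  transposition.\<close>

type_synonym 'n integrable_measure = "'n c0 cdual"

definition times_measure ::
    "'n::finite c0 \<Rightarrow> 'n integrable_measure \<Rightarrow> 'n integrable_measure"  (infixr \<open>\<odot>\<close> 75) where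
  "g \<odot> \<mu> = Abs_cdual (\<lambda>\<phi>. \<langle>g * \<phi>, \<mu>\<rangle>)"

lemma pairing_times_measure:
  fixes g :: "'n::finite c0"
  shows "\<langle>\<phi>, g \<odot> \<mu>\<rangle> = \<langle>g * \<phi>, \<mu>\<rangle>"
proof -
  have add: "g * (\<phi> + \<psi>) = g * \<phi> + g * \<psi>" and scale: "g * (c *\<^sub>C \<phi>) = c *\<^sub>C (g * \<phi>)"
    for \<phi> \<psi> :: "'n c0" and c :: complex
    by (rule c0_eqI; simp add: apply_c0_times apply_c0_ops algebra_simps)+
  have "norm (g * \<phi>) \<le> norm \<phi> * norm g" for \<phi> :: "'n c0"
    by (rule norm_c0_le)
      (auto simp: apply_c0_times norm_mult mult.commute[of "norm \<phi>"] intro!: mult_mono cmod_le_norm_c0)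
  then have "bounded_linear (\<lambda>\<phi> :: 'n c0. g * \<phi>)"
    by (intro bounded_linear_intro[where K = "norm g"]) (auto simp: add scale scaleR_scaleC)
  then show ?thesis
    unfolding times_measure_def
    by (subst pairing_Abs)
      (auto simp: scale pairing_scaleC_left intro: bounded_linear_compose[OF bounded_linear_pairing])
qed

text \<open>The convolution of a function \<open>h \<in> L\<^sup>1\<close> with an integrable measure \<open>\<nu>\<close> is given by
  \<open>\<langle>\<phi>, h * \<nu>\<rangle> = \<integral>\<integral> \<phi>(x + y) h(x) dx d\<nu>(y)\<close>, i.e. the transpose of
  \<open>\<phi> \<mapsto> (y \<mapsto> \<integral> h(x) \<phi>(x + y) dx)\<close>.\<close>

definition correlation :: "(real^'n::finite \<Rightarrow> complex) \<Rightarrow> 'n c0 \<Rightarrow> 'n c0" where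
  "correlation h \<phi> = Abs_c0 (\<lambda>y. \<integral>x. h x * \<phi> (x + y) \<partial>lborel)"

definition convolution ::
    "(real^'n::finite \<Rightarrow> complex) \<Rightarrow> 'n integrable_measure \<Rightarrow> 'n integrable_measure"
    (infixr \<open>\<star>\<close> 75) where
  "h \<star> \<nu> = Abs_cdual (\<lambda>\<phi>. \<langle>correlation h \<phi>, \<nu>\<rangle>)"

lemma integrable_mult_c0:
  fixes \<phi> :: "'n::finite c0"
  assumes "integrable lborel h"
  shows "integrable lborel (\<lambda>x. h x * \<phi> (x + y))"
proof (rule Bochner_Integration.integrable_bound[of _ "\<lambda>x. norm \<phi> * cmod (h x)"])
  show "integrable lborel (\<lambda>x. norm \<phi> * cmod (h x))" using assms by simp
  have "(\<lambda>x. \<phi> (x + y)) \<in> borel_measurable borel"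
    by (intro borel_measurable_continuous_onI continuous_on_compose2[OF continuous_on_c0]
        continuous_intros) auto
  then show "(\<lambda>x. h x * \<phi> (x + y)) \<in> borel_measurable lborel"
    using borel_measurable_integrable[OF assms] by simp
  show "AE x in lborel. cmod (h x * \<phi> (x + y)) \<le> norm (norm \<phi> * cmod (h x))"
    by (auto simp: norm_mult mult.commute[of "norm \<phi>"] intro!: mult_left_mono cmod_le_norm_c0)
qed

lemma tendsto_integral_c0:
  fixes \<phi> :: "'n::finite c0" and Y :: "nat \<Rightarrow> real^'n"
  assumes h: "integrable lborel h"
    and L: "\<And>x. (\<lambda>n. \<phi> (x + Y n)) \<longlonglongrightarrow> L x"
  shows "(\<lambda>n. \<integral>x. h x * \<phi> (x + Y n) \<partial>lborel) \<longlonglongrightarrow> (\<integral>x. h x * L x \<partial>lborel)"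
proof (rule integral_dominated_convergence[where w = "\<lambda>x. norm \<phi> * cmod (h x)"])
  show meas: "(\<lambda>x. h x * \<phi> (x + Y n)) \<in> borel_measurable lborel" for n
    by (rule borel_measurable_integrable[OF integrable_mult_c0[OF h]])
  have lim: "(\<lambda>n. h x * \<phi> (x + Y n)) \<longlonglongrightarrow> h x * L x" for x
    by (intro tendsto_mult_left L)
  then show "AE x in lborel. (\<lambda>n. h x * \<phi> (x + Y n)) \<longlonglongrightarrow> h x * L x" by simp
  show "(\<lambda>x. h x * L x) \<in> borel_measurable lborel"
    using lim meas by (rule borel_measurable_LIMSEQ_metric[rotated])
  show "integrable lborel (\<lambda>x. norm \<phi> * cmod (h x))" using h by simp
  show "AE x in lborel. cmod (h x * \<phi> (x + Y n)) \<le> norm \<phi> * cmod (h x)" for n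
    by (auto simp: norm_mult mult.commute[of "norm \<phi>"] intro!: mult_left_mono cmod_le_norm_c0)
qed

lemma apply_correlation:
  fixes \<phi> :: "'n::finite c0"
  assumes h: "integrable lborel h"
  shows "correlation h \<phi> y = (\<integral>x. h x * \<phi> (x + y) \<partial>lborel)"
proof -
  let ?c = "\<lambda>y. \<integral>x. h x * \<phi> (x + y) \<partial>lborel"
  have "continuous_on UNIV ?c"
    unfolding continuous_on_sequentially comp_def
  proof safe
    fix Y :: "nat \<Rightarrow> real^'n" and y assume "Y \<longlonglongrightarrow> y"
    then show "(\<lambda>n. ?c (Y n)) \<longlonglongrightarrow> ?c y"
      by (intro tendsto_integral_c0[OF h] continuous_on_tendsto_compose[OF continuous_on_c0[of UNIV]]
          tendsto_intros) auto
  qed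
  moreover have "(?c \<longlongrightarrow> 0) at_infinity"
  proof (rule ccontr)
    assume "\<not> (?c \<longlongrightarrow> 0) at_infinity"
    then obtain e where "0 < e" and e: "\<And>b. \<exists>y. b \<le> norm y \<and> \<not> dist (?c y) 0 < e"
      by (auto simp: tendsto_iff eventually_at_infinity)
    define Y where "Y n = (SOME y. real n \<le> norm y \<and> \<not> dist (?c y) 0 < e)" for n :: nat
    have Y: "real n \<le> norm (Y n)" "\<not> dist (?c (Y n)) 0 < e" for n
      using someI_ex[OF e[of "real n"]] unfolding Y_def by auto
    have "filterlim (\<lambda>n. norm (Y n)) at_top sequentially"
      by (rule filterlim_at_top_mono[OF filterlim_real_sequentially]) (use Y in auto)
    then have "filterlim Y at_infinity sequentially"
      by (simp add: filterlim_at_infinity_conv_norm_at_top)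
    then have "filterlim (\<lambda>n. x + Y n) at_infinity sequentially" for x
      by (intro tendsto_add_filterlim_at_infinity[OF tendsto_const])
    then have "(\<lambda>n. \<phi> (x + Y n)) \<longlonglongrightarrow> 0" for x
      by (rule filterlim_compose[OF tendsto_c0])
    from tendsto_integral_c0[OF h this] have "(\<lambda>n. ?c (Y n)) \<longlonglongrightarrow> 0" by simp
    from tendstoD[OF this \<open>0 < e\<close>] Y show False by simp
  qed
  ultimately show ?thesis unfolding correlation_def by (simp add: apply_Abs_c0)
qed

lemma pairing_convolution:
  fixes \<nu> :: "'n::finite integrable_measure"
  assumes h: "integrable lborel h"
  shows "\<langle>\<phi>, h \<star> \<nu>\<rangle> = \<langle>correlation h \<phi>, \<nu>\<rangle>"
proof -
  note int = integrable_mult_c0[OF h] and app = apply_correlation[OF h]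
  have add: "correlation h (\<phi> + \<psi>) = correlation h \<phi> + correlation h \<psi>" for \<phi> \<psi>
    by (rule c0_eqI) (simp add: app apply_c0_ops ring_distribs int)
  have scale: "correlation h (c *\<^sub>C \<phi>) = c *\<^sub>C correlation h \<phi>" for \<phi> c
    by (rule c0_eqI) (simp add: app apply_c0_ops mult.left_commute[of _ c])
  have "norm (correlation h \<phi>) \<le> norm \<phi> * (\<integral>x. cmod (h x) \<partial>lborel)" for \<phi>
  proof (rule norm_c0_le)
    fix y
    have "cmod (\<integral>x. h x * \<phi> (x + y) \<partial>lborel) \<le> (\<integral>x. norm \<phi> * cmod (h x) \<partial>lborel)"
      by (rule Bochner_Integration.integral_norm_bound_integral)
        (use h int in \<open>auto simp: norm_mult mult.commute[of "norm \<phi>"]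
          intro!: mult_left_mono cmod_le_norm_c0\<close>)
    then show "cmod (correlation h \<phi> y) \<le> norm \<phi> * (\<integral>x. cmod (h x) \<partial>lborel)"
      by (simp add: app)
  qed
  then have "bounded_linear (correlation h)"
    by (intro bounded_linear_intro[where K = "\<integral>x. cmod (h x) \<partial>lborel"])
      (auto simp: add scale scaleR_scaleC)
  then show ?thesis
    unfolding convolution_def
    by (subst pairing_Abs)
      (auto simp: scale pairing_scaleC_left intro: bounded_linear_compose[OF bounded_linear_pairing])
qed

definition p_seminorm ::
    "'n::finite c0 \<Rightarrow> (real^'n \<Rightarrow> complex) \<Rightarrow> 'n integrable_measure \<Rightarrow> real" where
  "p_seminorm g h \<mu> = norm (h \<star> (g \<odot> \<mu>))"

end

theory Submission
  imports Defs "HOL-Complex_Analysis.Great_Picard"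
begin

text \<open>Write \<open>T\<close> for the operator \<open>\<phi> \<mapsto> g \<cdot> correlation h \<phi>\<close> on \<open>C\<^sub>0\<close>. By transposition
  \<open>\<langle>\<phi>, h \<star> (g \<odot> \<mu>)\<rangle> = \<langle>T \<phi>, \<mu>\<rangle>\<close>, so \<open>p_seminorm g h \<mu>\<close> is the supremum of \<open>|\<langle>f, \<mu>\<rangle>|\<close> over the image
  under \<open>T\<close> of the unit ball. The two topologies are compared through such suprema.

  \<^emph>\<open>The seminorms are continuous for \<open>\<kappa>\<close>.\<close> The operator \<open>T\<close> is compact: translation is continuous in
  \<open>L\<^sup>1\<close>, so \<open>correlation h\<close> maps the unit ball to a uniformly equicontinuous set, and the factor
  \<open>g\<close> forces uniform decay at infinity, so Arzela--Ascoli applies. The closure of the image of the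
  unit ball is absolutely convex and compact (\<open>p_seminorm_le_sup_on_compact\<close>).

  \<^emph>\<open>The seminorms dominate.\<close> Given a compact \<open>K \<subseteq> C\<^sub>0\<close>, a single pair \<open>g, h\<close> with
  \<open>sup\<^sub>K |\<langle>f, \<mu>\<rangle>| \<le> C \<cdot> p_seminorm g h \<mu>\<close> is needed (\<open>compact_seminorm_le_p_seminorm\<close>). With \<open>g\<close> the
  square root of \<open>x \<mapsto> sup\<^sub>K |f x|\<close>, there is a factorization \<open>K \<subseteq> g \<cdot> L\<close> with \<open>L\<close> compact
  (\<open>compact_c0_factorization\<close>), and \<open>\<langle>g \<cdot> f, \<mu>\<rangle> = \<langle>f, g \<odot> \<mu>\<rangle>\<close>; so it remains to find an integrable
  \<open>h\<close> with \<open>|\<langle>f, \<nu>\<rangle>| \<le> C \<parallel>h \<star> \<nu>\<parallel>\<close> for all \<open>f \<in> L\<close> and all \<open>\<nu>\<close>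
  (\<open>uniform_bound_by_one_convolution\<close>). This is a dual form of Cohen's factorization theorem:
  with \<open>e\<^sub>k\<close> averages over balls that shrink very fast, put
  \<open>h = \<Sum>\<^sub>k \<onequarter> (\<threequarters>)\<^sup>k e\<^sub>k\<close>. The damped partial sums
  \<open>H\<^sub>n \<nu> = (\<Sum>k<n. \<onequarter> (\<threequarters>)\<^sup>k e\<^sub>k \<star> \<nu>) + (\<threequarters>)\<^sup>n \<nu>\<close> keep a trace of \<open>\<nu>\<close> itself, and so they
  are bounded below, with a constant \<open>4\<^sup>n\<close> that grows. The constant in
  \<open>|\<langle>f, \<nu>\<rangle>| \<le> C\<^sub>n \<parallel>H\<^sub>n \<nu>\<parallel>\<close>, however, stays bounded, because \<open>e\<^sub>n\<close> can be chosen after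
  \<open>e\<^sub>0, \<dots>, e\<^sub>n\<^sub>-\<^sub>1\<close> so concentrated that its error beats \<open>4\<^sup>n\<close>. Letting \<open>n\<close> tend to infinity gives the
  claim. Working with lower bounds for functionals, rather than solving \<open>f = correlation h \<psi>\<close>,
  avoids inverting any operator.\<close>

section \<open>Continuity of translation in \<open>L\<^sup>1\<close>\<close>

lemma lborel_integrable_translation:
  fixes h :: "'a::euclidean_space \<Rightarrow> 'b::{banach, second_countable_topology}"
  assumes "integrable lborel h"
  shows "integrable lborel (\<lambda>x. h (z + x))"
proof -
  have "integrable (distr lborel borel ((+) z)) h"
    using assms by (simp add: lborel_distr_plus)
  then show ?thesis
    by (subst (asm) integrable_distr_eq) (use borel_measurable_integrable[OF assms] in auto)
qed

lemma lborel_integral_translation: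
  fixes h :: "'a::euclidean_space \<Rightarrow> 'b::{banach, second_countable_topology}"
  assumes "h \<in> borel_measurable borel"
  shows "(\<integral>x. h (z + x) \<partial>lborel) = (\<integral>x. h x \<partial>lborel)"
  using integral_distr[of "(+) z" lborel borel h] assms by (simp add: lborel_distr_plus)

definition L1_shift_continuous ::
    "('a::euclidean_space \<Rightarrow> 'b::{banach, second_countable_topology}) \<Rightarrow> bool" where
  "L1_shift_continuous h \<longleftrightarrow>
     (\<forall>e>0. \<exists>d>0. \<forall>z. norm z < d \<longrightarrow> (\<integral>x. norm (h (z + x) - h x) \<partial>lborel) < e)"

lemma L1_shift_triangle:
  fixes h u :: "'a::euclidean_space \<Rightarrow> 'b::{banach, second_countable_topology}"
  assumes h: "integrable lborel h" and u: "integrable lborel u"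
  shows "(\<integral>x. norm (h (z + x) - h x) \<partial>lborel)
    \<le> (\<integral>x. norm (u (z + x) - u x) \<partial>lborel) + 2 * (\<integral>x. norm (h x - u x) \<partial>lborel)"
proof -
  note [simp] = lborel_integrable_translation h u
  have "(\<integral>x. norm (h (z + x) - h x) \<partial>lborel) \<le>
      (\<integral>x. norm (u (z + x) - u x) + (norm (h (z + x) - u (z + x)) + norm (h x - u x)) \<partial>lborel)"
  proof (rule integral_mono)
    show "norm (h (z + x) - h x)
        \<le> norm (u (z + x) - u x) + (norm (h (z + x) - u (z + x)) + norm (h x - u x))" for x
      using norm_triangle_ineq4[of "u (z + x) - u x + (h (z + x) - u (z + x))" "h x - u x"]
        norm_triangle_ineq[of "u (z + x) - u x" "h (z + x) - u (z + x)"]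
      by (simp add: algebra_simps)
  qed auto
  also have "\<dots> = (\<integral>x. norm (u (z + x) - u x) \<partial>lborel) +
      ((\<integral>x. norm (h (z + x) - u (z + x)) \<partial>lborel) + (\<integral>x. norm (h x - u x) \<partial>lborel))"
    by simp
  also have "(\<integral>x. norm (h (z + x) - u (z + x)) \<partial>lborel) = (\<integral>x. norm (h x - u x) \<partial>lborel)"
    by (rule lborel_integral_translation[of "\<lambda>x. norm (h x - u x)"])
      (use borel_measurable_integrable[OF h] borel_measurable_integrable[OF u] in auto)
  finally show ?thesis by simp
qed

lemma L1_shift_continuous_closed:
  fixes h :: "'a::euclidean_space \<Rightarrow> 'b::{banach, second_countable_topology}"
  assumes h: "integrable lborel h"
    and approx: "\<And>e. 0 < e \<Longrightarrow> \<exists>u. integrable lborel u \<and> L1_shift_continuous u \<and>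
        (\<integral>x. norm (h x - u x) \<partial>lborel) < e"
  shows "L1_shift_continuous h"
  unfolding L1_shift_continuous_def
proof (intro allI impI)
  fix e :: real assume "0 < e"
  then obtain u where u: "integrable lborel u" "L1_shift_continuous u"
    and hu: "(\<integral>x. norm (h x - u x) \<partial>lborel) < e / 4"
    using approx[of "e / 4"] by auto
  obtain d where "0 < d"
    and d: "\<And>z. norm z < d \<Longrightarrow> (\<integral>x. norm (u (z + x) - u x) \<partial>lborel) < e / 2"
    using u(2) \<open>0 < e\<close> unfolding L1_shift_continuous_def by (meson half_gt_zero)
  have "(\<integral>x. norm (h (z + x) - h x) \<partial>lborel) < e" if "norm z < d" for z
    using L1_shift_triangle[OF h u(1), of z] d[OF that] hu by linarith
  then show "\<exists>d>0. \<forall>z. norm z < d \<longrightarrow> (\<integral>x. norm (h (z + x) - h x) \<partial>lborel) < e"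
    using \<open>0 < d\<close> by blast
qed

text \<open>For an open set, \<open>1\<^sub>U(x + z)\<close> is eventually at least \<open>1\<^sub>U(x)\<close> as \<open>z \<rightarrow> 0\<close>, so the positive part of
  \<open>1\<^sub>U(x) - 1\<^sub>U(x + z)\<close> tends to \<open>0\<close> dominated by \<open>1\<^sub>U\<close>. As the difference has integral \<open>0\<close>, its
  positive and negative parts have the same integral, which controls the negative part too.\<close>
lemma L1_shift_continuous_open:
  fixes U :: "'a::euclidean_space set" and c :: "'b::{banach, second_countable_topology}"
  assumes U: "open U" and fin: "emeasure lborel U < \<infinity>"
  shows "L1_shift_continuous (\<lambda>x. indicator U x *\<^sub>R c)"
proof (rule ccontr)
  assume "\<not> ?thesis"
  then obtain e where "0 < e" and e: "\<And>d. 0 < d \<Longrightarrow> \<exists>z. norm z < d \<and>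
      e \<le> (\<integral>x. norm (indicator U (z + x) *\<^sub>R c - indicator U x *\<^sub>R c) \<partial>lborel)"
    unfolding L1_shift_continuous_def not_all not_imp not_ex de_Morgan_conj not_less
    by (metis not_le)
  define Z where "Z n = (SOME z. norm z < inverse (real (Suc n)) \<and>
      e \<le> (\<integral>x. norm (indicator U (z + x) *\<^sub>R c - indicator U x *\<^sub>R c) \<partial>lborel))" for n
  have Z: "norm (Z n) < inverse (real (Suc n))"
      "e \<le> (\<integral>x. norm (indicator U (Z n + x) *\<^sub>R c - indicator U x *\<^sub>R c) \<partial>lborel)" for n
    using someI_ex[OF e[of "inverse (real (Suc n))"]] unfolding Z_def by auto
  have Z0: "Z \<longlonglongrightarrow> 0"
    by (rule tendsto_norm_zero_cancel)
      (rule tendsto_sandwich[OF _ _ tendsto_const LIMSEQ_inverse_real_of_nat],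
        use Z(1) in \<open>auto intro!: always_eventually less_imp_le\<close>)
  have [measurable]: "U \<in> sets borel" using U by simp
  have int: "integrable lborel (indicator U :: 'a \<Rightarrow> real)"
    using fin U by (simp add: less_top)
  note [simp] = int lborel_integrable_translation[OF int]
  let ?pos = "\<lambda>n x. max 0 (indicator U x - indicator U (Z n + x)) :: real"
  have "(\<lambda>n. \<integral>x. ?pos n x \<partial>lborel) \<longlonglongrightarrow> (\<integral>x. 0 \<partial>(lborel :: 'a measure))"
  proof (rule integral_dominated_convergence[where w = "indicator U"])
    have "(\<lambda>n. ?pos n x) \<longlonglongrightarrow> 0" for x
    proof (cases "x \<in> U")
      case True
      have "(\<lambda>n. Z n + x) \<longlonglongrightarrow> x" using tendsto_add[OF Z0 tendsto_const[of x]] by simp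
      then have "\<forall>\<^sub>F n in sequentially. Z n + x \<in> U"
        using U True by (rule topological_tendstoD)
      then have "\<forall>\<^sub>F n in sequentially. ?pos n x = 0"
        by eventually_elim (simp add: True)
      then show ?thesis by (rule tendsto_eventually)
    next
      case False
      then have "?pos n x = 0" for n by (auto simp: indicator_def)
      then show ?thesis by simp
    qed
    then show "AE x in lborel. (\<lambda>n. ?pos n x) \<longlonglongrightarrow> 0" by simp
    show "AE x in lborel. norm (?pos n x) \<le> indicator U x" for n
      by (auto simp: indicator_def)
  qed (simp_all add: int)
  then have pos0: "(\<lambda>n. \<integral>x. ?pos n x \<partial>lborel) \<longlonglongrightarrow> 0" by simp
  \<comment> \<open>From \<open>|a - b| = 2 max 0 (a - b) - (a - b)\<close>, where the last term integrates to \<open>0\<close>.\<close>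
  have eq: "(\<integral>x. norm (indicator U (Z n + x) *\<^sub>R c - indicator U x *\<^sub>R c) \<partial>lborel)
      = 2 * norm c * (\<integral>x. ?pos n x \<partial>lborel)" for n
  proof -
    have "norm (indicator U (Z n + x) *\<^sub>R c - indicator U x *\<^sub>R c) =
        norm c * (2 * ?pos n x + indicator U (Z n + x) - indicator U x)" for x
      by (auto simp: indicator_def)
    moreover have "(\<integral>x. 2 * ?pos n x + indicator U (Z n + x) - indicator U x \<partial>lborel) =
        2 * (\<integral>x. ?pos n x \<partial>lborel) + (\<integral>x. indicator U (Z n + x) \<partial>lborel)
          - (\<integral>x. indicator U x \<partial>lborel)"
      by simp
    moreover have "(\<integral>x. indicator U (Z n + x) \<partial>lborel) = (\<integral>x. indicator U x \<partial>lborel :: real)"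
      by (rule lborel_integral_translation) simp
    ultimately show ?thesis by simp
  qed
  have "(\<lambda>n. 2 * norm c * (\<integral>x. ?pos n x \<partial>lborel)) \<longlonglongrightarrow> 0"
    using tendsto_mult_left[OF pos0, of "2 * norm c"] by simp
  from order_tendstoD(2)[OF this \<open>0 < e\<close>] Z(2) eq show False
    by (auto simp: eventually_sequentially not_less[symmetric])
qed

text \<open>The property is stable under sums and \<open>L\<^sup>1\<close> limits, so it suffices to treat indicators of Borel
  sets of finite measure; by outer regularity these are \<open>L\<^sup>1\<close> limits of indicators of open sets.\<close>
theorem L1_shift_continuous:
  fixes h :: "'a::euclidean_space \<Rightarrow> 'b::{banach, second_countable_topology}"
  assumes "integrable lborel h"
  shows "L1_shift_continuous h"
  using assms
proof (induction rule: integrable_induct)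
  case (base A c)
  have A[measurable]: "A \<in> sets borel" using base by simp
  have intA: "integrable lborel (\<lambda>x. indicator A x *\<^sub>R c)"
    using base by (simp add: less_top)
  show ?case
  proof (rule L1_shift_continuous_closed[OF intA])
    fix e :: real assume "0 < e"
    \<comment> \<open>The summand \<open>1\<close> covers the case \<open>c = 0\<close>.\<close>
    define r where "r = e / (norm c + 1)"
    have "0 < r" using \<open>0 < e\<close> by (simp add: r_def add_nonneg_pos)
    then obtain U where U: "open U" "A \<subseteq> U" "emeasure lborel (U - A) < r"
      using outer_regular_lborel[OF A] by blast
    have [measurable]: "U \<in> sets borel" using U by simp
    have "emeasure lborel U = emeasure lborel A + emeasure lborel (U - A)"
      using U by (subst plus_emeasure) (auto simp: Un_absorb1)
    then have fin: "emeasure lborel U < \<infinity>"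
      using order.strict_trans[OF U(3) ennreal_less_top] base(2) by simp
    have "norm (indicator A x *\<^sub>R c - indicator U x *\<^sub>R c) = indicator (U - A) x * norm c" for x
      using U(2) by (auto simp: indicator_def)
    then have "(\<integral>x. norm (indicator A x *\<^sub>R c - indicator U x *\<^sub>R c) \<partial>lborel)
        = measure lborel (U - A) * norm c"
      by simp
    also have "measure lborel (U - A) < r"
      using U(3) \<open>0 < r\<close> order.strict_trans[OF U(3) ennreal_less_top]
      by (subst (asm) emeasure_eq_ennreal_measure) (auto simp: ennreal_less_iff)
    then have "measure lborel (U - A) * norm c \<le> r * norm c" by (intro mult_right_mono) auto
    also have "\<dots> < e"
    proof -
      have "0 < norm c + 1" by (simp add: add_nonneg_pos)
      with \<open>0 < e\<close> show ?thesis by (simp add: r_def pos_divide_less_eq algebra_simps)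
    qed
    finally show "\<exists>u. integrable lborel u \<and> L1_shift_continuous u \<and>
        (\<integral>x. norm (indicator A x *\<^sub>R c - u x) \<partial>lborel) < e"
      using L1_shift_continuous_open[OF U(1) fin, of c] fin
      by (intro exI[of _ "\<lambda>x. indicator U x *\<^sub>R c"]) (auto simp: less_top)
  qed
next
  case (add f g)
  note [simp] = lborel_integrable_translation add.hyps
  show ?case
    unfolding L1_shift_continuous_def
  proof (intro allI impI)
    fix e :: real assume "0 < e"
    obtain d1 where d1: "0 < d1" "\<And>z. norm z < d1 \<Longrightarrow> (\<integral>x. norm (f (z + x) - f x) \<partial>lborel) < e / 2"
      using add.IH(1) \<open>0 < e\<close> unfolding L1_shift_continuous_def by (meson half_gt_zero)
    obtain d2 where d2: "0 < d2" "\<And>z. norm z < d2 \<Longrightarrow> (\<integral>x. norm (g (z + x) - g x) \<partial>lborel) < e / 2"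
      using add.IH(2) \<open>0 < e\<close> unfolding L1_shift_continuous_def by (meson half_gt_zero)
    have "(\<integral>x. norm (f (z + x) + g (z + x) - (f x + g x)) \<partial>lborel) < e"
      if "norm z < min d1 d2" for z
    proof -
      have "(\<integral>x. norm (f (z + x) + g (z + x) - (f x + g x)) \<partial>lborel)
          \<le> (\<integral>x. norm (f (z + x) - f x) + norm (g (z + x) - g x) \<partial>lborel)"
        by (rule integral_mono) (auto simp: norm_diff_triangle_ineq)
      also have "\<dots> = (\<integral>x. norm (f (z + x) - f x) \<partial>lborel) + (\<integral>x. norm (g (z + x) - g x) \<partial>lborel)"
        by simp
      finally show ?thesis using d1(2)[of z] d2(2)[of z] that by simp
    qed
    then show "\<exists>d>0. \<forall>z. norm z < d \<longrightarrow>
        (\<integral>x. norm (f (z + x) + g (z + x) - (f x + g x)) \<partial>lborel) < e"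
      using d1(1) d2(1) by (intro exI[of _ "min d1 d2"]) simp
  qed
next
  case (lim f s)
  show ?case
  proof (rule L1_shift_continuous_closed[OF lim.hyps(4)])
    fix e :: real assume "0 < e"
    have "(\<lambda>i. \<integral>x. norm (f x - s i x) \<partial>lborel) \<longlonglongrightarrow> (\<integral>x. 0 \<partial>(lborel :: 'a measure))"
    proof (rule integral_dominated_convergence[where w = "\<lambda>x. 3 * norm (f x)"])
      have "(\<lambda>i. norm (f x - s i x)) \<longlonglongrightarrow> 0" for x
        using tendsto_norm[OF tendsto_diff[OF tendsto_const[of "f x"] lim.hyps(2)[of x]]] by simp
      then show "AE x in lborel. (\<lambda>i. norm (f x - s i x)) \<longlonglongrightarrow> 0" by simp
      have "norm (f x - s i x) \<le> 3 * norm (f x)" for i x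
        using norm_triangle_ineq4[of "f x" "s i x"] lim.hyps(3)[of x i] by simp
      then show "AE x in lborel. norm (norm (f x - s i x)) \<le> 3 * norm (f x)" for i by simp
    qed (use lim.hyps borel_measurable_integrable in \<open>auto\<close>)
    then have "\<forall>\<^sub>F i in sequentially. (\<integral>x. norm (f x - s i x) \<partial>lborel) < e"
      using \<open>0 < e\<close> by (intro order_tendstoD) auto
    then obtain i where "(\<integral>x. norm (f x - s i x) \<partial>lborel) < e"
      by (auto simp: eventually_sequentially)
    then show "\<exists>u. integrable lborel u \<and> L1_shift_continuous u \<and> (\<integral>x. norm (f x - u x) \<partial>lborel) < e"
      using lim.hyps(1) lim.IH by blast
  qed
qed


section \<open>Uniform equicontinuity and compactness in \<open>C\<^sub>0\<close>\<close>

definition uniformly_equicontinuous :: "'n::finite c0 set \<Rightarrow> bool" where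
  "uniformly_equicontinuous Q \<longleftrightarrow>
     (\<forall>e>0. \<exists>d>0. \<forall>f\<in>Q. \<forall>x z. norm z < d \<longrightarrow> cmod (f (z + x) - f x) < e)"

lemma uniformly_equicontinuousD:
  assumes "uniformly_equicontinuous Q" "0 < e"
  obtains d where "0 < d"
    "\<And>f x z. f \<in> Q \<Longrightarrow> norm z < d \<Longrightarrow> cmod (apply_c0 f (z + x) - f x) < e"
proof -
  obtain d where "0 < d" "\<forall>f\<in>Q. \<forall>x z. norm z < d \<longrightarrow> cmod (f (z + x) - f x) < e"
    using assms unfolding uniformly_equicontinuous_def by meson
  then show thesis by (intro that[of d]) auto
qed

lemma uniformly_equicontinuous_Un:
  assumes "uniformly_equicontinuous P" "uniformly_equicontinuous Q"
  shows "uniformly_equicontinuous (P \<union> Q)"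
  unfolding uniformly_equicontinuous_def
proof (intro allI impI)
  fix e :: real assume e: "0 < e"
  obtain d1 where d1: "0 < d1"
      "\<And>f x z. f \<in> P \<Longrightarrow> norm z < d1 \<Longrightarrow> cmod (apply_c0 f (z + x) - f x) < e"
    using uniformly_equicontinuousD[OF assms(1) e] by blast
  obtain d2 where d2: "0 < d2"
      "\<And>f x z. f \<in> Q \<Longrightarrow> norm z < d2 \<Longrightarrow> cmod (apply_c0 f (z + x) - f x) < e"
    using uniformly_equicontinuousD[OF assms(2) e] by blast
  have "cmod (f (z + x) - f x) < e" if "f \<in> P \<union> Q" "norm z < min d1 d2" for f x z
    using that d1(2)[of f z x] d2(2)[of f z x] by auto
  then show "\<exists>d>0. \<forall>f\<in>P \<union> Q. \<forall>x z. norm z < d \<longrightarrow> cmod (f (z + x) - f x) < e"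
    using d1(1) d2(1) by (intro exI[of _ "min d1 d2"] conjI ballI allI impI) simp_all
qed

lemma c0_small_outside_ball:
  assumes "0 < e"
  obtains R where "0 < R" "\<And>x. R \<le> norm x \<Longrightarrow> cmod (apply_c0 f x) < e"
proof -
  have "\<forall>\<^sub>F x in at_infinity. cmod (f x) < e"
    using tendstoD[OF tendsto_c0[of f] assms] by simp
  then obtain b where b: "\<And>x. b \<le> norm x \<Longrightarrow> cmod (f x) < e"
    by (auto simp: eventually_at_infinity)
  show thesis by (rule that[of "max b 1"]) (use b in auto)
qed

lemma uniformly_equicontinuous_singleton: "uniformly_equicontinuous {f}"
  unfolding uniformly_equicontinuous_def
proof (intro allI impI)
  fix e :: real assume "0 < e"
  obtain R where "0 < R" and R: "\<And>x. R \<le> norm x \<Longrightarrow> cmod (apply_c0 f x) < e / 2"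
    using c0_small_outside_ball[of "e / 2" f] \<open>0 < e\<close> by auto
  have "uniformly_continuous_on (cball 0 (R + 1)) (apply_c0 f)"
    by (intro compact_uniformly_continuous continuous_on_c0) simp
  then obtain d where "0 < d" and d: "\<forall>x\<in>cball 0 (R + 1). \<forall>y\<in>cball 0 (R + 1).
      dist y x < d \<longrightarrow> dist (apply_c0 f y) (f x) < e"
    using \<open>0 < e\<close> unfolding uniformly_continuous_on_def by meson
  have "cmod (f (z + x) - f x) < e" if z: "norm z < min d 1" for x z
  proof (cases "norm x \<le> R + 1 \<and> norm (z + x) \<le> R + 1")
    case True
    then show ?thesis using bspec[OF bspec[OF d, of x], of "z + x"] z unfolding mem_cball_0 dist_norm by simp
  next
    case False
    then have "R \<le> norm x" "R \<le> norm (z + x)"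
      using z norm_triangle_ineq[of z x] norm_triangle_ineq4[of "z + x" z] by auto
    then have "cmod (f x) < e / 2" "cmod (f (z + x)) < e / 2" using R by auto
    then show ?thesis using norm_triangle_ineq4[of "f (z + x)" "f x"] by simp
  qed
  then show "\<exists>d>0. \<forall>f\<in>{f}. \<forall>x z. norm z < d \<longrightarrow> cmod (f (z + x) - f x) < e"
    using \<open>0 < d\<close> by (intro exI[of _ "min d 1"] conjI ballI allI impI) simp_all
qed

lemma uniformly_equicontinuous_finite:
  "finite F \<Longrightarrow> uniformly_equicontinuous F"
proof (induction F rule: finite_induct)
  case empty
  show ?case unfolding uniformly_equicontinuous_def by (auto intro: exI[of _ 1])
next
  case (insert f F)
  then show ?case
    using uniformly_equicontinuous_Un[OF uniformly_equicontinuous_singleton[of f]] by simp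
qed

lemma cmod_diff_le_dist_c0: "cmod (apply_c0 f x - apply_c0 g x) \<le> dist f g"
  using cmod_le_norm_c0[of "f - g" x] by (simp add: apply_c0_ops dist_norm)

lemma compact_imp_finite_net:
  assumes "compact K" "0 < e"
  obtains F where "finite F" "\<And>f. f \<in> K \<Longrightarrow> \<exists>f'\<in>F. dist f f' < e"
proof -
  obtain F where F: "finite F" "K \<subseteq> (\<Union>f\<in>F. ball f e)"
    using assms unfolding compact_eq_totally_bounded by blast
  have "\<exists>f'\<in>F. dist f f' < e" if "f \<in> K" for f
    using F(2) that by (force simp: dist_commute)
  with F(1) show thesis by (rule that)
qed

lemma compact_imp_uniformly_equicontinuous:
  fixes K :: "'n::finite c0 set"
  assumes "compact K"
  shows "uniformly_equicontinuous K"
  unfolding uniformly_equicontinuous_def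
proof (intro allI impI)
  fix e :: real assume "0 < e"
  then obtain F where F: "finite F" "\<And>f. f \<in> K \<Longrightarrow> \<exists>f'\<in>F. dist f f' < e / 3"
    using compact_imp_finite_net[OF assms, of "e / 3"] by auto
  obtain d where "0 < d"
    and d: "\<And>f x z. f \<in> F \<Longrightarrow> norm z < d \<Longrightarrow> cmod (apply_c0 f (z + x) - f x) < e / 3"
    using uniformly_equicontinuousD[OF uniformly_equicontinuous_finite[OF F(1)], of "e / 3"]
      \<open>0 < e\<close> by auto
  have "cmod (f (z + x) - f x) < e" if f: "f \<in> K" and z: "norm z < d" for f x z
  proof -
    obtain f' where f': "f' \<in> F" "dist f f' < e / 3" using F(2)[OF f] by blast
    have "cmod (f (z + x) - f x) \<le> cmod (f (z + x) - f' (z + x))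
        + cmod (f' (z + x) - f' x) + cmod (f' x - f x)"
      using norm_triangle_ineq[of "f (z + x) - f' (z + x)" "f' (z + x) - f' x"]
        norm_triangle_ineq[of "f (z + x) - f' x" "f' x - f x"] by simp
    then show ?thesis
      using d[OF f'(1) z, of x] f'(2) cmod_diff_le_dist_c0[of f "z + x" f']
        cmod_diff_le_dist_c0[of f' x f] by (simp add: dist_commute)
  qed
  then show "\<exists>d>0. \<forall>f\<in>K. \<forall>x z. norm z < d \<longrightarrow> cmod (f (z + x) - f x) < e"
    using \<open>0 < d\<close> by blast
qed

text \<open>A common bound \<open>|G| \<in> C\<^sub>0\<close> makes all members of \<open>S\<close> small off a fixed ball, and on that ball the
  classical theorem applies. This is used to show total boundedness: an infinite \<open>e\<close>-separated
  sequence in \<open>S\<close> would have a subsequence converging uniformly on the ball, hence two members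
  closer than \<open>e\<close>.\<close>
theorem Arzela_Ascoli_c0:
  fixes S :: "'n::finite c0 set" and G :: "'n c0"
  assumes equi: "uniformly_equicontinuous S"
    and dom: "\<And>f x. f \<in> S \<Longrightarrow> cmod (apply_c0 f x) \<le> cmod (G x)"
  shows "compact (closure S)"
proof -
  have net: "\<exists>F. finite F \<and> S \<subseteq> (\<Union>f\<in>F. ball f e)" if "0 < e" for e
  proof (rule ccontr)
    assume *: "\<not> ?thesis"
    have "\<exists>F :: nat \<Rightarrow> 'n c0. \<forall>n. F n \<in> S \<and> (\<forall>m<n. \<not> dist (F m) (F n) < e)"
    proof (rule dependent_wellorder_choice)
      fix n :: nat and F :: "nat \<Rightarrow> 'n c0"
      have "\<not> S \<subseteq> (\<Union>f\<in>F ` {..<n}. ball f e)" using * by blast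
      then show "\<exists>f. f \<in> S \<and> (\<forall>m<n. \<not> dist (F m) f < e)" by (auto simp: subset_eq)
    qed simp
    then obtain F :: "nat \<Rightarrow> 'n c0"
      where FS: "\<And>n. F n \<in> S" and sep: "\<And>m n. m < n \<Longrightarrow> e \<le> dist (F m) (F n)"
      by (auto simp: not_less)
    obtain R where "0 < R" and R: "\<And>x. R \<le> norm x \<Longrightarrow> cmod (G x) < e / 4"
      using c0_small_outside_ball[of "e / 4" G] \<open>0 < e\<close> by auto
    obtain g k where k: "strict_mono (k :: nat \<Rightarrow> nat)"
      and lim: "\<And>r. 0 < r \<Longrightarrow> \<exists>N. \<forall>n x. n \<ge> N \<and> x \<in> cball 0 R \<longrightarrow> cmod (F (k n) x - g x) < r"
    proof (rule Arzela_Ascoli[of "cball (0 :: real^'n) R" "\<lambda>n. apply_c0 (F n)" "norm G"])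
      show "cmod (F n x) \<le> norm G" for n x
        using dom[OF FS, of n x] cmod_le_norm_c0[of G x] by linarith
      show "\<exists>d>0. \<forall>n y. y \<in> cball 0 R \<and> norm (x - y) < d \<longrightarrow> cmod (F n x - F n y) < r"
        if r: "0 < r" for x r
      proof -
        obtain d where "0 < d"
          and d: "\<And>f x z. f \<in> S \<Longrightarrow> norm z < d \<Longrightarrow> cmod (apply_c0 f (z + x) - f x) < r"
          using uniformly_equicontinuousD[OF equi r] by blast
        have "norm (x - y) < d \<Longrightarrow> cmod (F n x - F n y) < r" for n y
          using d[OF FS, of "x - y" n y] by simp
        then show ?thesis using \<open>0 < d\<close> by blast
      qed
    qed auto
    obtain N where N: "\<And>n x. N \<le> n \<Longrightarrow> norm x \<le> R \<Longrightarrow> cmod (F (k n) x - g x) < e / 4"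
      using lim[of "e / 4"] \<open>0 < e\<close> by auto
    have "cmod ((F (k N) - F (k (Suc N))) x) \<le> e / 2" for x
    proof (cases "norm x \<le> R")
      case True
      then show ?thesis
        using N[of N x] N[of "Suc N" x]
          norm_triangle_ineq4[of "F (k N) x - g x" "F (k (Suc N)) x - g x"]
        by (simp add: apply_c0_ops)
    next
      case False
      then show ?thesis
        using R[of x] dom[OF FS, of "k N" x] dom[OF FS, of "k (Suc N)" x]
          norm_triangle_ineq4[of "F (k N) x" "F (k (Suc N)) x"]
        by (simp add: apply_c0_ops)
    qed
    then have "dist (F (k N)) (F (k (Suc N))) \<le> e / 2"
      unfolding dist_norm by (rule norm_c0_le)
    with sep[of "k N" "k (Suc N)"] k \<open>0 < e\<close> show False by (simp add: strict_mono_def)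
  qed
  have "\<exists>F. finite F \<and> closure S \<subseteq> (\<Union>f\<in>F. ball f e)" if "0 < e" for e
  proof -
    obtain F where F: "finite F" "S \<subseteq> (\<Union>f\<in>F. ball f (e / 2))"
      using net[of "e / 2"] \<open>0 < e\<close> by auto
    have "S \<subseteq> (\<Union>f\<in>F. cball f (e / 2))"
      by (rule order_trans[OF F(2) UN_mono[OF order_refl ball_subset_cball]])
    then have "closure S \<subseteq> (\<Union>f\<in>F. cball f (e / 2))"
      by (rule closure_minimal) (use F(1) in \<open>auto intro!: closed_UN\<close>)
    also have "\<dots> \<subseteq> (\<Union>f\<in>F. ball f e)" 
      using \<open>0 < e\<close> by (intro UN_mono order_refl subsetI) simp
    finally show ?thesis using F(1) by blast
  qed
  then show ?thesis
    by (simp add: compact_eq_totally_bounded complete_eq_closed)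
qed


section \<open>The seminorms are bounded by suprema over compact sets\<close>

lemma norm_correlation_le:
  fixes \<phi> :: "'n::finite c0"
  assumes h: "integrable lborel h"
  shows "norm (correlation h \<phi>) \<le> (\<integral>x. cmod (h x) \<partial>lborel) * norm \<phi>"
proof (rule norm_c0_le)
  fix y
  have "cmod (\<integral>x. h x * \<phi> (x + y) \<partial>lborel) \<le> (\<integral>x. cmod (h x) * norm \<phi> \<partial>lborel)"
    by (rule Bochner_Integration.integral_norm_bound_integral)
      (use h integrable_mult_c0[OF h] in \<open>auto simp: norm_mult intro!: mult_left_mono cmod_le_norm_c0\<close>)
  then show "cmod (correlation h \<phi> y) \<le> (\<integral>x. cmod (h x) \<partial>lborel) * norm \<phi>"
    by (simp add: apply_correlation[OF h])
qed

lemma correlation_add: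
  assumes h: "integrable lborel h"
  shows "correlation h (\<phi> + \<psi>) = correlation h \<phi> + correlation h \<psi>"
  by (rule c0_eqI)
    (simp add: apply_correlation[OF h] apply_c0_ops ring_distribs integrable_mult_c0[OF h])

lemma correlation_scaleC:
  assumes h: "integrable lborel h"
  shows "correlation h (c *\<^sub>C \<phi>) = c *\<^sub>C correlation h \<phi>"
  by (rule c0_eqI) (simp add: apply_correlation[OF h] apply_c0_ops mult.left_commute[of _ c])

text \<open>Translating the integration variable moves the shift from \<open>\<phi>\<close> to \<open>h\<close>; the modulus of continuity of
  \<open>correlation h \<phi>\<close> thus depends only on \<open>h\<close> and \<open>norm \<phi>\<close>.\<close>
lemma cmod_correlation_shift_le:
  fixes \<phi> :: "'n::finite c0"
  assumes h: "integrable lborel h"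
  shows "cmod (correlation h \<phi> (z + y) - correlation h \<phi> y)
    \<le> (\<integral>x. cmod (h (- z + x) - h x) \<partial>lborel) * norm \<phi>"
proof -
  note hz = lborel_integrable_translation[OF h, of "- z"]
  have "(\<integral>x. h x * \<phi> (x + (z + y)) \<partial>lborel) = (\<integral>x. h (- z + x) * \<phi> (x + y) \<partial>lborel)"
    using lborel_integral_translation[of "\<lambda>x. h x * \<phi> (x + (z + y))" "- z"]
      borel_measurable_integrable[OF integrable_mult_c0[OF h, of \<phi> "z + y"]]
    by (simp add: algebra_simps)
  then have "correlation h \<phi> (z + y) - correlation h \<phi> y
      = (\<integral>x. h (- z + x) * \<phi> (x + y) \<partial>lborel) - (\<integral>x. h x * \<phi> (x + y) \<partial>lborel)"
    by (simp only: apply_correlation[OF h])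
  also have "\<dots> = (\<integral>x. (h (- z + x) - h x) * \<phi> (x + y) \<partial>lborel)"
    unfolding left_diff_distrib
    by (rule Bochner_Integration.integral_diff[symmetric, OF integrable_mult_c0[OF hz]
        integrable_mult_c0[OF h]])
  also have "cmod \<dots> \<le> (\<integral>x. cmod (h (- z + x) - h x) * norm \<phi> \<partial>lborel)"
    by (rule Bochner_Integration.integral_norm_bound_integral)
      (use h hz integrable_mult_c0[OF Bochner_Integration.integrable_diff[OF hz h]]
       in \<open>auto simp: norm_mult intro!: mult_left_mono cmod_le_norm_c0\<close>)
  finally show ?thesis by simp
qed

lemma uniformly_equicontinuous_correlation:
  fixes h :: "real^'n::finite \<Rightarrow> complex"
  assumes h: "integrable lborel h"
  shows "uniformly_equicontinuous (correlation h ` cball 0 1)"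
  unfolding uniformly_equicontinuous_def
proof (intro allI impI)
  fix e :: real assume "0 < e"
  then obtain d where "0 < d"
    and d: "\<And>z. norm z < d \<Longrightarrow> (\<integral>x. cmod (h (z + x) - h x) \<partial>lborel) < e"
    using L1_shift_continuous[OF h] unfolding L1_shift_continuous_def by blast
  have "cmod (correlation h \<phi> (z + x) - correlation h \<phi> x) < e"
    if \<phi>: "norm \<phi> \<le> 1" and z: "norm z < d" for \<phi> :: "'n c0" and x z
  proof -
    have "cmod (correlation h \<phi> (z + x) - correlation h \<phi> x)
        \<le> (\<integral>x. cmod (h (- z + x) - h x) \<partial>lborel) * norm \<phi>"
      by (rule cmod_correlation_shift_le[OF h])
    also have "\<dots> \<le> (\<integral>x. cmod (h (- z + x) - h x) \<partial>lborel)"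
      using \<phi> by (intro mult_left_le) auto
    also have "\<dots> < e" by (rule d) (simp add: z)
    finally show ?thesis .
  qed
  then show "\<exists>d>0. \<forall>f\<in>correlation h ` cball 0 1. \<forall>x z. norm z < d \<longrightarrow> cmod (f (z + x) - f x) < e"
    using \<open>0 < d\<close> by (auto simp: dist_norm)
qed

lemma uniformly_equicontinuous_times:
  fixes g :: "'n::finite c0"
  assumes Q: "uniformly_equicontinuous Q" and B: "\<And>f. f \<in> Q \<Longrightarrow> norm f \<le> B"
  shows "uniformly_equicontinuous ((\<lambda>f. g * f) ` Q)"
  unfolding uniformly_equicontinuous_def
proof (intro allI impI)
  fix e :: real assume "0 < e"
  define C where "C = 1 + \<bar>B\<bar> + norm g"
  have C: "0 < C" "norm g \<le> C" "B \<le> C" 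
    using norm_ge_zero[of g] abs_ge_self[of B] by (simp_all add: C_def del: norm_ge_zero)
  define r where "r = e / (2 * C)"
  have "0 < r" using \<open>0 < e\<close> C(1) by (simp add: r_def)
  obtain d1 where d1: "0 < d1"
      "\<And>f x z. f \<in> {g} \<Longrightarrow> norm z < d1 \<Longrightarrow> cmod (apply_c0 f (z + x) - f x) < r"
    by (rule uniformly_equicontinuousD[OF uniformly_equicontinuous_singleton[of g] \<open>0 < r\<close>]) blast
  obtain d2 where d2: "0 < d2"
      "\<And>f x z. f \<in> Q \<Longrightarrow> norm z < d2 \<Longrightarrow> cmod (apply_c0 f (z + x) - f x) < r"
    by (rule uniformly_equicontinuousD[OF Q \<open>0 < r\<close>]) blast
  have "cmod ((g * f) (z + x) - (g * f) x) < e"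
    if f: "f \<in> Q" and z: "norm z < min d1 d2" for f x z
  proof -
    have "(g * f) (z + x) - (g * f) x
        = (g (z + x) - g x) * f (z + x) + g x * (f (z + x) - f x)"
      by (simp add: apply_c0_times algebra_simps)
    also have "cmod \<dots> \<le> cmod (g (z + x) - g x) * cmod (f (z + x))
        + cmod (g x) * cmod (f (z + x) - f x)"
      by (metis norm_triangle_ineq norm_mult)
    also have "\<dots> \<le> cmod (g (z + x) - g x) * C + C * cmod (f (z + x) - f x)"
      using cmod_le_norm_c0[of f "z + x"] cmod_le_norm_c0[of g x] B[OF f] C
      by (intro add_mono mult_left_mono mult_right_mono) auto
    also have "\<dots> < r * C + C * r"
      using d1(2)[of g z x] d2(2)[OF f, of z x] z C(1)
      by (intro add_strict_mono mult_strict_left_mono mult_strict_right_mono) auto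
    also have "\<dots> = e" using C(1) by (simp add: r_def)
    finally show ?thesis .
  qed
  then show "\<exists>d>0. \<forall>f\<in>(\<lambda>f. g * f) ` Q. \<forall>x z. norm z < d \<longrightarrow> cmod (f (z + x) - f x) < e"
    using d1(1) d2(1) by (intro exI[of _ "min d1 d2"] conjI ballI allI impI) auto
qed

lemma scaleC_diff_right: "a *\<^sub>C (x - y) = a *\<^sub>C x - a *\<^sub>C (y :: 'a::complex_normed_vector)"
  using scaleC_add_right[of a "x - y" y] by simp

lemma tendsto_scaleC:
  fixes X :: "nat \<Rightarrow> 'a::complex_normed_vector"
  assumes "X \<longlonglongrightarrow> x"
  shows "(\<lambda>n. a *\<^sub>C X n) \<longlonglongrightarrow> a *\<^sub>C x"
proof -
  have "(\<lambda>n. cmod a * norm (X n - x)) \<longlonglongrightarrow> cmod a * 0"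
    using assms by (intro tendsto_mult_left tendsto_norm_zero) (simp add: LIM_zero_iff)
  then have "(\<lambda>n. norm (a *\<^sub>C X n - a *\<^sub>C x)) \<longlonglongrightarrow> 0"
    by (simp add: norm_scaleC flip: scaleC_diff_right)
  then show ?thesis by (simp add: tendsto_norm_zero_iff LIM_zero_iff)
qed

lemma absolutely_convex_closure:
  assumes "absolutely_convex S"
  shows "absolutely_convex (closure S)"
  unfolding absolutely_convex_def
proof (intro ballI allI impI)
  fix x y and a b :: complex
  assume x: "x \<in> closure S" and y: "y \<in> closure S" and ab: "cmod a + cmod b \<le> 1"
  obtain X where X: "\<And>n. X n \<in> S" "X \<longlonglongrightarrow> x" using x closure_sequential by blast
  obtain Y where Y: "\<And>n. Y n \<in> S" "Y \<longlonglongrightarrow> y" using y closure_sequential by blast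
  have "a *\<^sub>C X n + b *\<^sub>C Y n \<in> S" for n
    using assms X(1) Y(1) ab unfolding absolutely_convex_def by blast
  moreover have "(\<lambda>n. a *\<^sub>C X n + b *\<^sub>C Y n) \<longlonglongrightarrow> a *\<^sub>C x + b *\<^sub>C y"
    by (intro tendsto_add tendsto_scaleC X Y)
  ultimately show "a *\<^sub>C x + b *\<^sub>C y \<in> closure S"
    unfolding closure_sequential by (intro exI[of _ "\<lambda>n. a *\<^sub>C X n + b *\<^sub>C Y n"]) blast
qed

lemma pairing_convolution_times:
  assumes "integrable lborel h"
  shows "\<langle>\<phi>, h \<star> (g \<odot> \<mu>)\<rangle> = \<langle>g * correlation h \<phi>, \<mu>\<rangle>"
  by (simp add: pairing_convolution[OF assms] pairing_times_measure)

text \<open>The set \<open>K\<close> is the closure of \<open>{g * correlation h \<phi> | norm \<phi> \<le> 1}\<close>. Its members are dominated by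
  a multiple of \<open>|g|\<close>, which gives the uniform decay in \<open>Arzela_Ascoli_c0\<close>.\<close>
theorem p_seminorm_le_sup_on_compact:
  fixes g :: "'n::finite c0"
  assumes h: "integrable lborel h"
  obtains K where "compact K" "absolutely_convex K"
    "\<And>\<mu> e. (\<And>f. f \<in> K \<Longrightarrow> cmod \<langle>f, \<mu>\<rangle> \<le> e) \<Longrightarrow> p_seminorm g h \<mu> \<le> e"
proof
  let ?I = "\<integral>x. cmod (h x) \<partial>lborel"
  let ?S = "(\<lambda>f. g * f) ` correlation h ` cball 0 1"
  have I: "norm (correlation h \<phi>) \<le> ?I" if "norm \<phi> \<le> 1" for \<phi>
    using norm_correlation_le[OF h, of \<phi>] mult_left_le[OF that, of ?I] by simp
  show "compact (closure ?S)"
  proof (rule Arzela_Ascoli_c0)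
    show "uniformly_equicontinuous ?S"
      by (rule uniformly_equicontinuous_times[OF uniformly_equicontinuous_correlation[OF h]])
        (use I in \<open>auto simp: dist_norm\<close>)
    fix f x assume "f \<in> ?S"
    then obtain \<phi> where \<phi>: "norm \<phi> \<le> 1" and f: "f = g * correlation h \<phi>"
      by (auto simp: dist_norm)
    have "cmod (correlation h \<phi> x) \<le> ?I"
      using cmod_le_norm_c0[of "correlation h \<phi>" x] I[OF \<phi>] by linarith
    then have "cmod (g x) * cmod (correlation h \<phi> x) \<le> cmod (g x) * ?I"
      by (intro mult_left_mono) auto
    then show "cmod (f x) \<le> cmod ((complex_of_real ?I *\<^sub>C g) x)"
      by (simp add: f apply_c0_times apply_c0_ops norm_mult mult.commute)
  qed
  have "absolutely_convex ?S"
    unfolding absolutely_convex_def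
  proof (intro ballI allI impI)
    fix x y and a b :: complex assume "x \<in> ?S" "y \<in> ?S" and ab: "cmod a + cmod b \<le> 1"
    then obtain \<phi> \<psi> where \<phi>: "norm \<phi> \<le> 1" "x = g * correlation h \<phi>"
      and \<psi>: "norm \<psi> \<le> 1" "y = g * correlation h \<psi>"
      by (auto simp: dist_norm)
    have "norm (a *\<^sub>C \<phi> + b *\<^sub>C \<psi>) \<le> cmod a * norm \<phi> + cmod b * norm \<psi>"
      using norm_triangle_ineq[of "a *\<^sub>C \<phi>" "b *\<^sub>C \<psi>"] by (simp add: norm_scaleC)
    also have "\<dots> \<le> cmod a + cmod b"
      using \<phi>(1) \<psi>(1) by (intro add_mono mult_left_le) auto
    finally have "norm (a *\<^sub>C \<phi> + b *\<^sub>C \<psi>) \<le> 1" using ab by simp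
    moreover have "a *\<^sub>C x + b *\<^sub>C y = g * correlation h (a *\<^sub>C \<phi> + b *\<^sub>C \<psi>)"
      by (rule c0_eqI) (simp add: \<phi>(2) \<psi>(2) correlation_add[OF h] correlation_scaleC[OF h]
          apply_c0_times apply_c0_ops algebra_simps)
    ultimately show "a *\<^sub>C x + b *\<^sub>C y \<in> ?S" by (simp only:) (intro imageI, simp)
  qed
  then show "absolutely_convex (closure ?S)" by (rule absolutely_convex_closure)
  show "p_seminorm g h \<mu> \<le> e" if "\<And>f. f \<in> closure ?S \<Longrightarrow> cmod \<langle>f, \<mu>\<rangle> \<le> e" for \<mu> e
    unfolding p_seminorm_def
  proof (rule norm_cdual_le)
    fix \<phi> :: "'n c0" assume "norm \<phi> \<le> 1"
    then have "g * correlation h \<phi> \<in> closure ?S"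
      by (intro subsetD[OF closure_subset] imageI) simp
    from that[OF this] show "cmod \<langle>\<phi>, h \<star> (g \<odot> \<mu>)\<rangle> \<le> e" by (simp only: pairing_convolution_times[OF h])
  qed
qed

section \<open>Splitting off a common factor from a compact set\<close>

text \<open>The quotient is extended by \<open>0\<close> to the zeros of \<open>G\<close>, in agreement with the convention \<open>a / 0 = 0\<close>;
  the assumed bound makes this extension continuous.\<close>
lemma continuous_at_quotient_zero:
  fixes f G :: "'a::t2_space \<Rightarrow> complex"
  assumes f: "isCont f x" and G: "isCont G x" and le: "\<And>y. cmod (f y / G y) \<le> cmod (G y)"
  shows "isCont (\<lambda>y. f y / G y) x"
proof (cases "G x = 0")
  case False
  then show ?thesis using f G by (intro continuous_intros) auto
next
  case True
  have "((\<lambda>y. cmod (G y)) \<longlongrightarrow> 0) (at x)"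
    using tendsto_norm[OF G[unfolded isCont_def]] True by simp
  then have "((\<lambda>y. f y / G y) \<longlongrightarrow> 0) (at x)"
    by (rule Lim_null_comparison[rotated]) (use le in \<open>auto intro: always_eventually\<close>)
  then show ?thesis by (simp add: isCont_def True)
qed

text \<open>Let \<open>m = sup\<^sub>K |f|\<close> and \<open>G = \<surd>m\<close>. Compactness of \<open>K\<close> makes \<open>m\<close>, hence \<open>G\<close>, continuous and
  vanishing at infinity. The quotients satisfy \<open>|f / G| \<le> G\<close>, and from \<open>|f - f'| \<le> 2m\<close> one gets
  \<open>|f - f'|\<^sup>2 / m \<le> 2 |f - f'|\<close>: the map \<open>f \<mapsto> f / G\<close> is Hoelder continuous of exponent \<open>1/2\<close> on
  \<open>K\<close>, and its image is the required compact set.\<close>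
theorem compact_c0_factorization:
  fixes K :: "'n::finite c0 set"
  assumes "compact K"
  obtains g L where "compact L" "K \<subseteq> (\<lambda>f. g * f) ` L"
proof (cases "K = {}")
  case True
  show thesis by (rule that[of "{}" 0]) (simp_all add: True)
next
  case False
  define m where "m x = (SUP f\<in>K. cmod (apply_c0 f x))" for x
  obtain b where b: "\<And>f. f \<in> K \<Longrightarrow> norm f \<le> b"
    using compact_imp_bounded[OF assms] bounded_iff by metis
  have "cmod (f x) \<le> b" if "f \<in> K" for f x
    using b[OF that] cmod_le_norm_c0[of f x] by linarith
  then have bdd: "bdd_above ((\<lambda>f. cmod (apply_c0 f x)) ` K)" for x by (rule bdd_aboveI2)
  have le_m: "cmod (f x) \<le> m x" if "f \<in> K" for f x
    unfolding m_def by (rule cSUP_upper[OF that bdd])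
  have m_le: "m x \<le> e" if "\<And>f. f \<in> K \<Longrightarrow> cmod (f x) \<le> e" for x e
    unfolding m_def by (rule cSUP_least[OF False that])
  have m_nonneg: "0 \<le> m x" for x
    using False le_m norm_ge_zero order_trans by (metis ex_in_conv)
  have "continuous_on UNIV m"
    unfolding continuous_on_iff
  proof (intro ballI allI impI)
    fix x :: "real^'n" and e :: real assume "0 < e"
    obtain d where "0 < d"
      and d: "\<And>f x z. f \<in> K \<Longrightarrow> norm z < d \<Longrightarrow> cmod (apply_c0 f (z + x) - f x) < e / 2"
      using uniformly_equicontinuousD[OF compact_imp_uniformly_equicontinuous[OF assms], of "e / 2"]
        \<open>0 < e\<close> by auto
    have m_close: "m x \<le> m y + e / 2" if "dist x y < d" for x y
    proof (rule m_le)
      fix f assume f: "f \<in> K"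
      show "cmod (f x) \<le> m y + e / 2"
        using d[OF f, of "x - y" y] that le_m[OF f, of y] norm_triangle_sub[of "f x" "f y"]
        unfolding dist_norm diff_add_cancel by linarith
    qed
    have "dist (m y) (m x) < e" if "dist y x < d" for y
    proof -
      have "m x \<le> m y + e / 2" "m y \<le> m x + e / 2"
        using m_close[of x y] m_close[of y x] that by (simp_all add: dist_commute)
      then show ?thesis using \<open>0 < e\<close> unfolding dist_real_def by linarith
    qed
    then show "\<exists>d>0. \<forall>y\<in>UNIV. dist y x < d \<longrightarrow> dist (m y) (m x) < e"
      using \<open>0 < d\<close> by blast
  qed
  then have "continuous_on UNIV (\<lambda>x. complex_of_real (sqrt (m x)))"
    by (intro continuous_intros)
  moreover have "((\<lambda>x. complex_of_real (sqrt (m x))) \<longlongrightarrow> 0) at_infinity"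
  proof -
    have "(m \<longlongrightarrow> 0) at_infinity"
    proof (rule tendstoI)
      fix e :: real assume "0 < e"
      obtain F where F: "finite F" "\<And>f. f \<in> K \<Longrightarrow> \<exists>f'\<in>F. dist f f' < e / 3"
        using compact_imp_finite_net[OF assms, of "e / 3"] \<open>0 < e\<close> by auto
      have "\<forall>\<^sub>F x in at_infinity. dist (apply_c0 f' x) 0 < e / 3" for f' :: "'n c0"
        using \<open>0 < e\<close> by (intro tendstoD[OF tendsto_c0]) simp
      then have "\<forall>\<^sub>F x in at_infinity. \<forall>f'\<in>F. dist (apply_c0 f' x) 0 < e / 3"
        using F(1) by (intro eventually_ball_finite) auto
      then show "\<forall>\<^sub>F x in at_infinity. dist (m x) 0 < e"
      proof eventually_elim
        case (elim x)
        have "m x \<le> 2 * e / 3"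
        proof (rule m_le)
          fix f assume "f \<in> K"
          then obtain f' where f': "f' \<in> F" "dist f f' < e / 3" using F(2) by blast
          show "cmod (f x) \<le> 2 * e / 3"
            using bspec[OF elim f'(1)] f'(2) cmod_diff_le_dist_c0[of f x f']
              norm_triangle_sub[of "f x" "f' x"]
            unfolding dist_0_norm dist_commute[of _ 0] by linarith
        qed
        then show ?case using \<open>0 < e\<close> m_nonneg[of x] by simp
      qed
    qed
    from tendsto_real_sqrt[OF this] show ?thesis
      using tendsto_of_real[of "\<lambda>x. sqrt (m x)" 0 at_infinity] by simp
  qed
  ultimately obtain G :: "'n c0" where G: "\<And>x. G x = complex_of_real (sqrt (m x))"
    using apply_Abs_c0 by metis
  have GG: "cmod (G x) * cmod (G x) = m x" and G0: "G x = 0 \<longleftrightarrow> m x = 0" for x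
    using m_nonneg[of x] by (simp_all add: G)
  have quot_le: "cmod (f x / G x) \<le> cmod (G x)" if "f \<in> K" for f x
    using le_m[OF that, of x] GG[of x] by (cases "G x = 0") (auto simp: norm_divide divide_le_eq)
  have quot: "apply_c0 (Abs_c0 (\<lambda>x. f x / G x)) = (\<lambda>x. f x / G x)" if f: "f \<in> K" for f
  proof (rule apply_Abs_c0)
    show "continuous_on UNIV (\<lambda>x. f x / G x)"
      using continuous_on_c0[of UNIV] quot_le[OF f]
      by (auto simp: continuous_on_eq_continuous_at intro!: continuous_at_quotient_zero)
    have "((\<lambda>x. cmod (G x)) \<longlongrightarrow> 0) at_infinity" using tendsto_norm[OF tendsto_c0[of G]] by simp
    then show "((\<lambda>x. f x / G x) \<longlongrightarrow> 0) at_infinity"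
      by (rule Lim_null_comparison[rotated]) (use quot_le[OF f] in \<open>auto intro: always_eventually\<close>)
  qed
  define q :: "'n c0 \<Rightarrow> 'n c0" where "q f = Abs_c0 (\<lambda>x. f x / G x)" for f
  have q: "q f x = f x / G x" if "f \<in> K" for f x by (simp add: q_def quot[OF that])
  have q_dist: "dist (q f) (q f') \<le> sqrt (2 * dist f f')" if f: "f \<in> K" and f': "f' \<in> K" for f f'
    unfolding dist_norm[of "q f"]
  proof (rule norm_c0_le)
    fix x
    have le: "(cmod (f x - f' x))\<^sup>2 \<le> dist f f' * (2 * m x)"
      unfolding power2_eq_square
    proof (rule mult_mono)
      show "cmod (f x - f' x) \<le> 2 * m x"
        using norm_triangle_ineq4[of "f x" "f' x"] le_m[OF f, of x] le_m[OF f', of x] by simp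
    qed (auto simp: cmod_diff_le_dist_c0)
    have eq: "(cmod (q f x - q f' x))\<^sup>2 * m x = (cmod (f x - f' x))\<^sup>2" if "m x \<noteq> 0"
    proof -
      have "cmod (q f x - q f' x) * cmod (G x) = cmod (f x - f' x)"
        using that G0[of x] by (simp add: q[OF f] q[OF f'] left_diff_distrib flip: norm_mult)
      then show ?thesis unfolding GG[symmetric] power2_eq_square by (metis mult.assoc mult.left_commute)
    qed
    have "(cmod (q f x - q f' x))\<^sup>2 \<le> 2 * dist f f'"
    proof (cases "m x = 0")
      case True
      then show ?thesis using G0[of x] by (simp add: q[OF f] q[OF f'])
    next
      case False
      with m_nonneg[of x] have "0 < m x" by simp
      moreover have "(cmod (q f x - q f' x))\<^sup>2 * m x \<le> (2 * dist f f') * m x"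
        using le eq[OF False] by (simp add: mult.assoc mult.left_commute)
      ultimately show ?thesis by (rule mult_right_le_imp_le[rotated])
    qed
    then show "cmod ((q f - q f') x) \<le> sqrt (2 * dist f f')"
      by (simp add: apply_c0_ops real_le_rsqrt)
  qed
  have "continuous_on K q"
    unfolding continuous_on_iff
  proof (intro ballI allI impI)
    fix f and e :: real assume f: "f \<in> K" and "0 < e"
    have "dist (q f') (q f) < e" if f': "f' \<in> K" "dist f' f < e\<^sup>2 / 2" for f'
    proof -
      have "sqrt (2 * dist f' f) < sqrt (e\<^sup>2)" using f'(2) by (intro real_sqrt_less_mono) simp
      with q_dist[OF f'(1) f] \<open>0 < e\<close> show ?thesis by simp
    qed
    then show "\<exists>d>0. \<forall>f'\<in>K. dist f' f < d \<longrightarrow> dist (q f') (q f) < e"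
      using \<open>0 < e\<close> by (intro exI[of _ "e\<^sup>2 / 2"]) auto
  qed
  then have "compact (q ` K)" using assms by (rule compact_continuous_image)
  moreover have "G * q f = f" if f: "f \<in> K" for f
  proof (rule c0_eqI)
    fix x
    have "f x = 0" if "G x = 0" using le_m[OF f, of x] G0[of x] that by simp
    then show "(G * q f) x = f x" by (cases "G x = 0") (simp_all add: apply_c0_times q[OF f])
  qed
  then have "K \<subseteq> (\<lambda>f. G * f) ` q ` K"
    by (intro subsetI) (rule image_eqI[OF sym imageI])
  ultimately show thesis by (rule that)
qed


section \<open>Kernels that concentrate fast\<close>

lemma cmod_pairing_le: "cmod \<langle>x, \<mu>\<rangle> \<le> norm x * norm \<mu>"
proof (cases "x = 0")
  case False
  have "cmod \<langle>x, \<mu>\<rangle> = norm x * cmod \<langle>x /\<^sub>R norm x, \<mu>\<rangle>"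
    using False by (simp add: pairing_scaleR_left norm_mult norm_inverse)
  also have "\<dots> \<le> norm x * norm \<mu>"
    using False by (intro mult_left_mono cmod_pairing_le_norm) auto
  finally show ?thesis .
qed (simp add: pairing_zero_left)

lemma pairing_diff_left: "\<langle>x - y, \<mu>\<rangle> = \<langle>x, \<mu>\<rangle> - \<langle>y, \<mu>\<rangle>"
  using pairing_add_left[of "x - y" y \<mu>] by simp

lemma pairing_sum_left: "\<langle>\<Sum>k\<in>I. f k, \<mu>\<rangle> = (\<Sum>k\<in>I. \<langle>f k, \<mu>\<rangle>)"
  by (induction I rule: infinite_finite_induct) (simp_all add: pairing_add_left pairing_zero_left)

lemma pairing_sum_right: "\<langle>x, \<Sum>k\<in>I. \<mu> k\<rangle> = (\<Sum>k\<in>I. \<langle>x, \<mu> k\<rangle>)"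
  by (induction I rule: infinite_finite_induct) (simp_all add: pairing_ops)

text \<open>The kernel is the normalised indicator of the ball of radius \<open>d\<close>: the value of \<open>correlation e f\<close> at
  \<open>y\<close> is the mean of \<open>f\<close> over the ball around \<open>y\<close>.\<close>
lemma local_average_kernel:
  fixes d :: real
  assumes "0 < d"
  obtains e :: "real^'n::finite \<Rightarrow> complex"
  where "integrable lborel e" "(\<integral>x. cmod (e x) \<partial>lborel) \<le> 1"
    "\<And>f r. (\<And>x z. norm z < d \<Longrightarrow> cmod (apply_c0 f (z + x) - f x) \<le> r) \<Longrightarrow>
        norm (correlation e f - f) \<le> r"
proof
  let ?B = "ball (0 :: real^'n) d"
  define v where "v = measure lborel ?B"
  have "0 < v" using content_ball_pos[OF assms] by (simp add: v_def)
  define w :: "real^'n \<Rightarrow> real" where "w x = indicator ?B x / v" for x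
  let ?e = "\<lambda>x. complex_of_real (w x)"
  have int: "integrable lborel w"
    unfolding w_def
    by (intro integrable_divide integrable_real_indicator) (simp_all add: emeasure_lborel_ball_finite[unfolded infinity_ennreal_def])
  have one: "(\<integral>x. w x \<partial>lborel) = 1"
    using \<open>0 < v\<close> unfolding w_def by (simp add: v_def)
  have pos: "0 \<le> w x" for x using \<open>0 < v\<close> by (simp add: w_def)
  show e: "integrable lborel ?e" using int by simp
  show "(\<integral>x. cmod (?e x) \<partial>lborel) \<le> 1" using one pos by (simp add: abs_of_nonneg)
  show "norm (correlation ?e f - f) \<le> r"
    if r: "\<And>x z. norm z < d \<Longrightarrow> cmod (apply_c0 f (z + x) - f x) \<le> r" for f r
  proof (rule norm_c0_le)
    fix y
    have "f y = (\<integral>x. ?e x * f y \<partial>lborel)" using one by simp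
    then have "(correlation ?e f - f) y = (\<integral>x. ?e x * f (x + y) \<partial>lborel) - (\<integral>x. ?e x * f y \<partial>lborel)"
      by (simp add: apply_c0_ops apply_correlation[OF e])
    also have "\<dots> = (\<integral>x. ?e x * f (x + y) - ?e x * f y \<partial>lborel)"
      by (rule Bochner_Integration.integral_diff[symmetric, OF integrable_mult_c0[OF e]])
        (use e in simp)
    also have "cmod \<dots> \<le> (\<integral>x. w x * r \<partial>lborel)"
    proof (rule Bochner_Integration.integral_norm_bound_integral)
      show "integrable lborel (\<lambda>x. ?e x * f (x + y) - ?e x * f y)"
        using integrable_mult_c0[OF e] e by simp
      show "cmod (?e x * f (x + y) - ?e x * f y) \<le> w x * r" for x
      proof (cases "norm x < d")
        case True
        have "cmod (?e x * f (x + y) - ?e x * f y) = w x * cmod (f (x + y) - f y)"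
          using pos[of x] by (simp add: norm_mult flip: right_diff_distrib)
        also have "\<dots> \<le> w x * r" using r[OF True, of y] pos[of x] by (rule mult_left_mono)
        finally show ?thesis .
      qed (simp add: w_def)
    qed (use int in simp)
    also have "\<dots> = r" using one by simp
    finally show "cmod ((correlation ?e f - f) y) \<le> r" .
  qed
qed

lemma approximating_kernel:
  fixes Q :: "'n::finite c0 set"
  assumes Q: "uniformly_equicontinuous Q" and r: "0 < r"
  shows "\<exists>e. integrable lborel e \<and> (\<integral>x. cmod (e x) \<partial>lborel) \<le> 1 \<and>
    (\<forall>f\<in>Q. norm (correlation e f - f) \<le> r)"
proof -
  obtain d where "0 < d"
    and d: "\<And>f x z. f \<in> Q \<Longrightarrow> norm z < d \<Longrightarrow> cmod (apply_c0 f (z + x) - f x) < r"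
    by (rule uniformly_equicontinuousD[OF Q r]) blast
  obtain e :: "real^'n \<Rightarrow> complex"
    where e: "integrable lborel e" "(\<integral>x. cmod (e x) \<partial>lborel) \<le> 1"
    and le: "\<And>f r. (\<And>x z. norm z < d \<Longrightarrow> cmod (apply_c0 f (z + x) - f x) \<le> r) \<Longrightarrow>
        norm (correlation e f - f) \<le> r"
    by (rule local_average_kernel[OF \<open>0 < d\<close>]) blast
  have "\<forall>f\<in>Q. norm (correlation e f - f) \<le> r"
    by (intro ballI le less_imp_le d)
  with e show ?thesis by blast
qed

text \<open>Each kernel is chosen after its predecessors: their correlations with the unit ball form finitely
  many uniformly equicontinuous sets, so one further kernel can almost reproduce all of them, and the
  set \<open>Q\<close> as well.\<close>
lemma kernel_sequence:
  fixes Q :: "'n::finite c0 set"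
  assumes Q: "uniformly_equicontinuous Q" and r: "\<And>n. 0 < r n"
  obtains e :: "nat \<Rightarrow> real^'n \<Rightarrow> complex"
  where "\<And>n. integrable lborel (e n)" "\<And>n. (\<integral>x. cmod (e n x) \<partial>lborel) \<le> 1"
    "\<And>n f. f \<in> Q \<Longrightarrow> norm (correlation (e n) f - f) \<le> r n"
    "\<And>k n \<phi>. k < n \<Longrightarrow> norm \<phi> \<le> 1 \<Longrightarrow>
        norm (correlation (e n) (correlation (e k) \<phi>) - correlation (e k) \<phi>) \<le> r n"
proof -
  define P where "P e n u \<longleftrightarrow> integrable lborel u \<and> (\<integral>x. cmod (u x) \<partial>lborel) \<le> 1 \<and>
      (\<forall>f\<in>Q \<union> (\<Union>k<n. correlation (e k) ` cball 0 1). norm (correlation u f - f) \<le> r n)"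
    for e :: "nat \<Rightarrow> real^'n \<Rightarrow> complex" and n u
  have "\<exists>e. \<forall>n. P e n (e n)"
  proof (rule dependent_wellorder_choice)
    show "P e n u = P e' n u" if "\<And>k. k < n \<Longrightarrow> e k = e' k" for u e e' n
      using that by (simp add: P_def)
    show "\<exists>u. P e n u" if e: "\<And>k. k < n \<Longrightarrow> P e k (e k)" for e n
    proof -
      have "uniformly_equicontinuous (Q \<union> (\<Union>k<m. correlation (e k) ` cball 0 1))" if "m \<le> n" for m
        using that
      proof (induction m)
        case 0
        then show ?case using Q by simp
      next
        case (Suc m)
        have "integrable lborel (e m)" using e[of m] Suc.prems by (simp add: P_def)
        from uniformly_equicontinuous_Un[OF Suc.IH uniformly_equicontinuous_correlation[OF this]]
        show ?case using Suc.prems by (simp add: lessThan_Suc Un_ac)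
      qed
      from approximating_kernel[OF this[OF order_refl] r[of n]] show ?thesis by (simp add: P_def)
    qed
  qed
  then obtain e where e: "\<And>n. P e n (e n)" by blast
  show thesis
  proof (rule that[of e])
    show "integrable lborel (e n)" "(\<integral>x. cmod (e n x) \<partial>lborel) \<le> 1" for n
      using e[of n] by (simp_all add: P_def)
    show "norm (correlation (e n) f - f) \<le> r n" if "f \<in> Q" for n f
      using e[of n] that unfolding P_def by (meson UnI1)
    show "norm (correlation (e n) (correlation (e k) \<phi>) - correlation (e k) \<phi>) \<le> r n"
      if "k < n" "norm \<phi> \<le> 1" for k n \<phi>
    proof -
      have "correlation (e k) \<phi> \<in> (\<Union>k<n. correlation (e k) ` cball 0 1)"
        using that by (intro UN_I[of k] imageI) simp_all
      then show ?thesis using e[of n] unfolding P_def by (meson UnI2)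
    qed
  qed
qed

text \<open>Absolute convergence in \<open>L\<^sup>1\<close> yields absolute convergence of the series almost everywhere, which
  allows integration term by term.\<close>
lemma correlation_series:
  fixes F :: "nat \<Rightarrow> real^'n::finite \<Rightarrow> complex"
  assumes int: "\<And>k. integrable lborel (F k)"
    and sum: "summable (\<lambda>k. \<integral>x. cmod (F k x) \<partial>lborel)"
  shows "integrable lborel (\<lambda>x. \<Sum>k. F k x)"
    and "(\<lambda>k. correlation (F k) \<phi> y) sums correlation (\<lambda>x. \<Sum>k. F k x) \<phi> y"
proof -
  have [measurable]: "F k \<in> borel_measurable borel" for k
    using borel_measurable_integrable[OF int] by simp
  have "(\<integral>\<^sup>+x. (\<Sum>k. ennreal (cmod (F k x))) \<partial>lborel) = (\<Sum>k. \<integral>\<^sup>+x. cmod (F k x) \<partial>lborel)"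
    by (rule nn_integral_suminf) simp
  also have "\<dots> = (\<Sum>k. ennreal (\<integral>x. cmod (F k x) \<partial>lborel))"
    by (intro suminf_cong nn_integral_eq_integral) (use int in auto)
  also have "\<dots> = ennreal (\<Sum>k. \<integral>x. cmod (F k x) \<partial>lborel)"
    by (rule suminf_ennreal2[OF _ sum]) simp
  finally have "(\<integral>\<^sup>+x. (\<Sum>k. ennreal (cmod (F k x))) \<partial>lborel) \<noteq> \<infinity>" by simp
  then have "AE x in lborel. (\<Sum>k. ennreal (cmod (F k x))) \<noteq> \<infinity>"
    by (intro nn_integral_PInf_AE) simp_all
  then have AE: "AE x in lborel. summable (\<lambda>k. cmod (F k x))"
    by eventually_elim (auto intro: summable_suminf_not_top)
  show int_h: "integrable lborel (\<lambda>x. \<Sum>k. F k x)" by (rule integrable_suminf[OF int AE sum])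
  note intF = integrable_mult_c0[OF int, of _ \<phi> y]
  have bound: "cmod (F k x * \<phi> (x + y)) \<le> cmod (F k x) * norm \<phi>" for k x
    by (simp add: norm_mult mult_left_mono cmod_le_norm_c0)
  have AE': "AE x in lborel. summable (\<lambda>k. cmod (F k x * \<phi> (x + y)))"
    using AE
  proof eventually_elim
    case (elim x)
    show ?case
      by (rule summable_comparison_test'[OF summable_mult2[OF elim, of "norm \<phi>"]])
        (use bound in simp)
  qed
  have sum': "summable (\<lambda>k. \<integral>x. cmod (F k x * \<phi> (x + y)) \<partial>lborel)"
  proof (rule summable_comparison_test'[OF summable_mult2[OF sum, of "norm \<phi>"]])
    fix k
    have "(\<integral>x. cmod (F k x * \<phi> (x + y)) \<partial>lborel) \<le> (\<integral>x. cmod (F k x) * norm \<phi> \<partial>lborel)"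
      by (rule integral_mono) (use intF int bound in auto)
    then show "norm (\<integral>x. cmod (F k x * \<phi> (x + y)) \<partial>lborel)
        \<le> (\<integral>x. cmod (F k x) \<partial>lborel) * norm \<phi>" by simp
  qed
  have "(\<integral>x. (\<Sum>k. F k x) * \<phi> (x + y) \<partial>lborel) = (\<integral>x. (\<Sum>k. F k x * \<phi> (x + y)) \<partial>lborel)"
  proof (rule integral_cong_AE)
    show "AE x in lborel. (\<Sum>k. F k x) * \<phi> (x + y) = (\<Sum>k. F k x * \<phi> (x + y))"
      using AE by eventually_elim (rule suminf_mult2[OF summable_norm_cancel])
  qed (use borel_measurable_integrable[OF integrable_mult_c0[OF int_h]]
      borel_measurable_integrable[OF integrable_suminf[OF intF AE' sum']] in simp_all)
  with sums_integral[OF intF AE' sum']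
  show "(\<lambda>k. correlation (F k) \<phi> y) sums correlation (\<lambda>x. \<Sum>k. F k x) \<phi> y"
    by (simp add: apply_correlation[OF int] apply_correlation[OF int_h])
qed

section \<open>The damped sums\<close>

text \<open>The operators \<open>A k\<close> model convolution with the \<open>k\<close>-th kernel. The weights \<open>\<onequarter> (\<threequarters>)\<^sup>k\<close> for \<open>k < n\<close>
  together with \<open>(\<threequarters>)\<^sup>n\<close> sum to \<open>1\<close>. The errors \<open>8\<^sup>-\<^sup>n\<^sup>-\<^sup>1\<close> remain summable after
  multiplication by \<open>4\<^sup>n\<close>, the constant in \<open>damped_sum_bounded_below\<close>.\<close>

context
  fixes A :: "nat \<Rightarrow> 'v::real_normed_vector \<Rightarrow> 'v" and H :: "nat \<Rightarrow> 'v \<Rightarrow> 'v"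
  assumes lin: "\<And>k. linear (A k)"
    and contr: "\<And>k \<nu>. norm (A k \<nu>) \<le> norm \<nu>"
    and almost: "\<And>k n \<nu>. k < n \<Longrightarrow> norm (A k (A n \<nu> - \<nu>)) \<le> norm \<nu> / 8 ^ Suc n"
    and H_def: "\<And>n \<nu>. H n \<nu> = (\<Sum>k<n. (1/4 * (3/4) ^ k) *\<^sub>R A k \<nu>) + (3/4) ^ n *\<^sub>R \<nu>"
begin

lemma damped_sum_linear: "linear (H n)"
proof (rule linearI)
  note A_simps = linear_add[OF lin] linear_scale[OF lin]
  show "H n (\<mu> + \<nu>) = H n \<mu> + H n \<nu>" for \<mu> \<nu>
    by (simp add: H_def A_simps scaleR_add_right sum.distrib)
  show "H n (c *\<^sub>R \<nu>) = c *\<^sub>R H n \<nu>" for c \<nu>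
    by (simp add: H_def A_simps scaleR_add_right scaleR_sum_right mult.commute mult.left_commute)
qed

text \<open>Passing from \<open>n\<close> to \<open>n + 1\<close> replaces \<open>(\<threequarters>)\<^sup>n \<nu>\<close> by \<open>(\<threequarters>)\<^sup>n ((3/4) \<nu> + (1/4) A n \<nu>)\<close>. The same
  replacement inside the other summands changes them little, since \<open>A k (A n \<nu>)\<close> is close to
  \<open>A k \<nu>\<close>. So \<open>H (n + 1) \<nu>\<close> is nearly \<open>H n\<close> of a small perturbation of \<open>\<nu>\<close>, which makes induction on
  \<open>n\<close> possible.\<close>
lemma damped_sum_step:
  "norm (H n (\<nu> + (1/4) *\<^sub>R (A n \<nu> - \<nu>))) \<le> norm (H (Suc n) \<nu>) + norm \<nu> / (4 * 8 ^ Suc n)"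
proof -
  let ?\<delta> = "A n \<nu> - \<nu>"
  let ?S = "\<Sum>k<n. (1/4 * (3/4) ^ k) *\<^sub>R A k ?\<delta>"
  have "H (Suc n) \<nu> = H n \<nu> + (1/4 * (3/4) ^ n) *\<^sub>R ?\<delta>"
  proof -
    have "(3/4) ^ Suc n *\<^sub>R \<nu> = (3/4) ^ n *\<^sub>R \<nu> - (1/4 * (3/4) ^ n) *\<^sub>R \<nu>"
      by (simp flip: scaleR_left_diff_distrib)
    then show ?thesis
      by (simp add: H_def scaleR_right_diff_distrib algebra_simps del: power_Suc)
  qed
  moreover have "H n (\<nu> + (1/4) *\<^sub>R ?\<delta>) = H n \<nu> + (1/4) *\<^sub>R H n ?\<delta>"
    by (simp only: linear_add[OF damped_sum_linear] linear_scale[OF damped_sum_linear])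
  moreover have "(1/4) *\<^sub>R H n ?\<delta> = (1/4) *\<^sub>R ?S + (1/4 * (3/4) ^ n) *\<^sub>R ?\<delta>"
    by (simp only: H_def scaleR_add_right scaleR_scaleR)
  ultimately have eq: "H n (\<nu> + (1/4) *\<^sub>R ?\<delta>) = H (Suc n) \<nu> + (1/4) *\<^sub>R ?S" by simp
  have "norm ?S \<le> (\<Sum>k<n. (1/4 * (3/4) ^ k) * (norm \<nu> / 8 ^ Suc n))"
  proof (rule sum_norm_le)
    fix k assume "k \<in> {..<n}"
    then have "norm (A k ?\<delta>) \<le> norm \<nu> / 8 ^ Suc n" by (intro almost) simp
    then have "(1/4 * (3/4) ^ k) * norm (A k ?\<delta>) \<le> (1/4 * (3/4) ^ k) * (norm \<nu> / 8 ^ Suc n)"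
      by (rule mult_left_mono) simp
    then show "norm ((1/4 * (3/4) ^ k) *\<^sub>R A k ?\<delta>) \<le> (1/4 * (3/4) ^ k) * (norm \<nu> / 8 ^ Suc n)"
      by simp
  qed
  also have "\<dots> = (\<Sum>k<n. 1/4 * (3/4) ^ k) * (norm \<nu> / 8 ^ Suc n)"
    by (rule sum_distrib_right[symmetric])
  also have "(\<Sum>k<n. 1/4 * (3/4 :: real) ^ k) = 1 - (3/4) ^ n"
    by (induction n) (simp_all add: field_simps)
  also have "(1 - (3/4) ^ n) * (norm \<nu> / 8 ^ Suc n) \<le> norm \<nu> / 8 ^ Suc n"
    by (intro mult_left_le_one_le) (auto simp: power_le_one)
  finally have "norm ((1/4) *\<^sub>R ?S) \<le> norm \<nu> / (4 * 8 ^ Suc n)" by simp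
  then show ?thesis unfolding eq by (intro norm_triangle_le add_left_mono)
qed

text \<open>The perturbed element \<open>(3/4) \<nu> + (1/4) A n \<nu>\<close> has norm at least \<open>norm \<nu> / 2\<close>; each step therefore loses
  a factor \<open>2\<close>, and the remaining factor \<open>2\<close> absorbs the error of \<open>damped_sum_step\<close>.\<close>
lemma damped_sum_bounded_below: "norm \<nu> \<le> 4 ^ n * norm (H n \<nu>)"
proof (induction n arbitrary: \<nu>)
  case 0
  show ?case by (simp add: H_def)
next
  case (Suc n)
  let ?\<delta> = "A n \<nu> - \<nu>"
  have "norm ?\<delta> \<le> 2 * norm \<nu>" using norm_triangle_ineq4[of "A n \<nu>" \<nu>] contr[of n \<nu>] by simp
  then have "norm \<nu> / 2 \<le> norm (\<nu> + (1/4) *\<^sub>R ?\<delta>)"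
    using norm_diff_ineq[of \<nu> "(1/4) *\<^sub>R ?\<delta>"] by simp
  also have "\<dots> \<le> 4 ^ n * norm (H n (\<nu> + (1/4) *\<^sub>R ?\<delta>))" by (rule Suc.IH)
  also have "\<dots> \<le> 4 ^ n * (norm (H (Suc n) \<nu>) + norm \<nu> / (4 * 8 ^ Suc n))"
    by (intro mult_left_mono damped_sum_step) simp
  also have "\<dots> = 4 ^ n * norm (H (Suc n) \<nu>) + (1/2) ^ n * (norm \<nu> / 32)"
    by (simp add: distrib_left field_simps flip: power_mult_distrib)
  also have "(1/2) ^ n * (norm \<nu> / 32) \<le> norm \<nu> / 32"
    by (intro mult_left_le_one_le) (auto simp: power_le_one)
  finally have "norm \<nu> / 2 \<le> 4 ^ n * norm (H (Suc n) \<nu>) + norm \<nu> / 32" by simp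
  moreover have "0 \<le> 4 ^ n * norm (H (Suc n) \<nu>)" by simp
  ultimately show ?case unfolding power_Suc by linarith
qed

text \<open>Unlike the norm, a functional that hardly distinguishes \<open>\<nu>\<close> from \<open>A n \<nu>\<close> loses no factor at each
  step, only an error of size \<open>8\<^sup>-\<^sup>n\<^sup>-\<^sup>1 norm \<nu>\<close>. By \<open>damped_sum_bounded_below\<close> this is at most a multiple of
  \<open>2\<^sup>-\<^sup>n norm (H (n + 1) \<nu>)\<close>, so the constants form a bounded sequence.\<close>
lemma functional_le_damped_sum:
  fixes l :: "'v \<Rightarrow> complex"
  assumes l: "linear l" and M: "1 \<le> M" "\<And>\<nu>. cmod (l \<nu>) \<le> M * norm \<nu>"
    and small: "\<And>n \<nu>. cmod (l (A n \<nu> - \<nu>)) \<le> norm \<nu> / 8 ^ Suc n"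
  shows "cmod (l \<nu>) \<le> M * (2 - (1/2) ^ n) * norm (H n \<nu>)"
proof (induction n arbitrary: \<nu>)
  case 0
  show ?case using M(2)[of \<nu>] by (simp add: H_def)
next
  case (Suc n)
  let ?\<delta> = "A n \<nu> - \<nu>"
  let ?C = "M * (2 - (1/2) ^ n)"
  have C: "0 \<le> ?C" "?C \<le> 2 * M"
    using M(1) power_le_one[of "1/2 :: real" n] by (auto simp: mult_le_cancel_left)
  have "l \<nu> = l (\<nu> + (1/4) *\<^sub>R ?\<delta>) - (1/4) *\<^sub>R l ?\<delta>"
    by (simp only: linear_add[OF l] linear_scale[OF l]) simp
  then have "cmod (l \<nu>) \<le> cmod (l (\<nu> + (1/4) *\<^sub>R ?\<delta>)) + cmod (l ?\<delta>) / 4"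
    using norm_triangle_ineq4[of "l (\<nu> + (1/4) *\<^sub>R ?\<delta>)" "(1/4) *\<^sub>R l ?\<delta>"] by simp
  also have "\<dots> \<le> ?C * (norm (H (Suc n) \<nu>) + norm \<nu> / (4 * 8 ^ Suc n)) + norm \<nu> / (4 * 8 ^ Suc n)"
    using order_trans[OF Suc.IH mult_left_mono[OF damped_sum_step C(1)]]
      divide_right_mono[OF small[of n \<nu>], of 4]
    by (intro add_mono) (simp_all add: mult.commute)
  also have "\<dots> = ?C * norm (H (Suc n) \<nu>) + (?C + 1) * (norm \<nu> / (4 * 8 ^ Suc n))"
    by (simp only: distrib_left distrib_right mult_1_left add.assoc)
  also have "(?C + 1) * (norm \<nu> / (4 * 8 ^ Suc n))
      \<le> 3 * M * (4 ^ Suc n * norm (H (Suc n) \<nu>) / (4 * 8 ^ Suc n))"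
  proof (intro mult_mono divide_right_mono damped_sum_bounded_below)
    show "?C + 1 \<le> 3 * M" using C(2) M(1) by linarith
  qed (use M(1) in auto)
  also have "\<dots> = 3 / 4 * (M * (1/2) ^ Suc n * norm (H (Suc n) \<nu>))"
    by (simp add: field_simps flip: power_mult_distrib)
  also have "\<dots> \<le> M * (1/2) ^ Suc n * norm (H (Suc n) \<nu>)"
    using M(1) by (intro mult_left_le_one_le) auto
  finally show ?case by (simp add: algebra_simps)
qed

end

section \<open>Domination by a single convolution\<close>

text \<open>The kernel is \<open>h = \<Sum>\<^sub>k \<onequarter> (\<threequarters>)\<^sup>k e\<^sub>k\<close> with \<open>e\<close> from \<open>kernel_sequence\<close>. Since
  \<open>norm (H n \<nu> - h \<star> \<nu>) \<le> 2 (3/4)\<^sup>n norm \<nu>\<close> and the constants in \<open>functional_le_damped_sum\<close> do not exceed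
  \<open>2 * M\<close>, the bound survives the limit.\<close>
theorem uniform_bound_by_one_convolution:
  fixes L :: "'n::finite c0 set"
  assumes equi: "uniformly_equicontinuous L" and M: "1 \<le> M" "\<And>f. f \<in> L \<Longrightarrow> norm f \<le> M"
  obtains h :: "real^'n \<Rightarrow> complex"
  where "integrable lborel h" "\<And>f \<nu>. f \<in> L \<Longrightarrow> cmod \<langle>f, \<nu>\<rangle> \<le> 2 * M * norm (h \<star> \<nu>)"
proof -
  obtain e :: "nat \<Rightarrow> real^'n \<Rightarrow> complex"
    where e: "\<And>n. integrable lborel (e n)" "\<And>n. (\<integral>x. cmod (e n x) \<partial>lborel) \<le> 1"
    and eL: "\<And>n f. f \<in> L \<Longrightarrow> norm (correlation (e n) f - f) \<le> 1 / 8 ^ Suc n"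
    and ee: "\<And>k n \<phi>. k < n \<Longrightarrow> norm \<phi> \<le> 1 \<Longrightarrow>
        norm (correlation (e n) (correlation (e k) \<phi>) - correlation (e k) \<phi>) \<le> 1 / 8 ^ Suc n"
    by (rule kernel_sequence[OF equi, of "\<lambda>n. 1 / 8 ^ Suc n"]) (simp, blast)
  define c :: "nat \<Rightarrow> real" where "c k = 1/4 * (3/4) ^ k" for k
  define F where "F k x = complex_of_real (c k) * e k x" for k x
  have c: "0 \<le> c k" for k by (simp add: c_def)
  have c_tail: "(\<lambda>k. c (k + n)) sums (3/4) ^ n" for n
    using sums_mult[OF geometric_sums[of "3/4 :: real"], of "1/4 * (3/4) ^ n"]
    by (simp add: c_def power_add mult_ac)
  have intF: "integrable lborel (F k)" for k unfolding F_def using e(1) by simp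
  have "(\<integral>x. cmod (F k x) \<partial>lborel) = c k * (\<integral>x. cmod (e k x) \<partial>lborel)" for k
    using c[of k] by (simp add: F_def norm_mult)
  then have F1: "(\<integral>x. cmod (F k x) \<partial>lborel) \<le> c k" for k
    using mult_left_mono[OF e(2) c, of k] by simp
  have corrF: "correlation (F k) \<phi> = complex_of_real (c k) *\<^sub>C correlation (e k) \<phi>" for k \<phi>
    by (rule c0_eqI)
      (simp add: apply_correlation[OF intF] apply_correlation[OF e(1)] apply_c0_ops, simp add: F_def mult.assoc)
  have sumF: "summable (\<lambda>k. \<integral>x. cmod (F k x) \<partial>lborel)"
    by (rule summable_comparison_test'[OF sums_summable[OF c_tail[of 0, simplified]]])
      (use F1 in simp)
  define h where "h x = (\<Sum>k. F k x)" for x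
  have h: "integrable lborel h"
    and h_sums: "\<And>\<phi> y. (\<lambda>k. correlation (F k) \<phi> y) sums correlation h \<phi> y"
    unfolding h_def by (rule correlation_series[OF intF sumF])+
  define H where "H n \<nu> = (\<Sum>k<n. (1/4 * (3/4) ^ k) *\<^sub>R (e k \<star> \<nu>)) + (3/4) ^ n *\<^sub>R \<nu>"
    for n and \<nu> :: "'n integrable_measure"
  have pair: "\<langle>\<phi>, e k \<star> \<nu>\<rangle> = \<langle>correlation (e k) \<phi>, \<nu>\<rangle>" for \<phi> k \<nu>
    by (rule pairing_convolution[OF e(1)])
  have lin: "linear (\<lambda>\<nu>. e k \<star> \<nu>)" for k
    by (rule linearI; rule cdual_eqI) (simp_all add: pairing_ops pair)
  have contr: "norm (e k \<star> \<nu>) \<le> norm \<nu>" for k \<nu>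
  proof (rule norm_cdual_le)
    fix \<phi> :: "'n c0" assume \<phi>: "norm \<phi> \<le> 1"
    then have "norm (correlation (e k) \<phi>) \<le> 1"
      using norm_correlation_le[OF e(1), of k \<phi>] mult_le_one[OF e(2)[of k] norm_ge_zero \<phi>]
      by linarith
    then show "cmod \<langle>\<phi>, e k \<star> \<nu>\<rangle> \<le> norm \<nu>"
      using cmod_pairing_le_norm by (simp only: pair)
  qed
  have almost: "norm (e k \<star> (e n \<star> \<nu> - \<nu>)) \<le> norm \<nu> / 8 ^ Suc n" if "k < n" for k n \<nu>
  proof (rule norm_cdual_le)
    fix \<phi> :: "'n c0" assume "norm \<phi> \<le> 1"
    let ?\<psi> = "correlation (e n) (correlation (e k) \<phi>) - correlation (e k) \<phi>"
    have "\<langle>\<phi>, e k \<star> (e n \<star> \<nu> - \<nu>)\<rangle> = \<langle>?\<psi>, \<nu>\<rangle>"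
      by (simp add: pair pairing_ops pairing_diff_left)
    also have "cmod \<dots> \<le> norm ?\<psi> * norm \<nu>" by (rule cmod_pairing_le)
    also have "\<dots> \<le> 1 / 8 ^ Suc n * norm \<nu>"
      by (rule mult_right_mono[OF ee[OF that \<open>norm \<phi> \<le> 1\<close>] norm_ge_zero])
    finally show "cmod \<langle>\<phi>, e k \<star> (e n \<star> \<nu> - \<nu>)\<rangle> \<le> norm \<nu> / 8 ^ Suc n" by simp
  qed
  have bound_H: "cmod \<langle>f, \<nu>\<rangle> \<le> M * (2 - (1/2) ^ n) * norm (H n \<nu>)" if f: "f \<in> L" for f \<nu> n
  proof (rule functional_le_damped_sum[where A = "\<lambda>k \<nu>. e k \<star> \<nu>" and H = H])
    show "linear (\<lambda>\<nu>. \<langle>f, \<nu>\<rangle>)"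
      by (rule linearI) (simp_all add: pairing_ops scaleR_conv_of_real)
    show "cmod \<langle>f, \<nu>\<rangle> \<le> M * norm \<nu>" for \<nu>
      using cmod_pairing_le[of f \<nu>] mult_right_mono[OF M(2)[OF f] norm_ge_zero[of \<nu>]] by linarith
    show "cmod \<langle>f, e n \<star> \<nu> - \<nu>\<rangle> \<le> norm \<nu> / 8 ^ Suc n" for n \<nu>
    proof -
      have "\<langle>f, e n \<star> \<nu> - \<nu>\<rangle> = \<langle>correlation (e n) f - f, \<nu>\<rangle>"
        by (simp add: pair pairing_ops pairing_diff_left)
      also have "cmod \<dots> \<le> norm (correlation (e n) f - f) * norm \<nu>" by (rule cmod_pairing_le)
      also have "\<dots> \<le> 1 / 8 ^ Suc n * norm \<nu>" by (rule mult_right_mono[OF eL[OF f] norm_ge_zero])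
      finally show ?thesis by simp
    qed
  qed (use lin contr almost M(1) in \<open>simp_all add: H_def del: power_Suc\<close>)
  have H_close: "norm (H n \<nu> - h \<star> \<nu>) \<le> 2 * (3/4) ^ n * norm \<nu>" for n \<nu>
  proof (rule norm_cdual_le)
    fix \<phi> :: "'n c0" assume \<phi>: "norm \<phi> \<le> 1"
    let ?\<psi> = "(\<Sum>k<n. correlation (F k) \<phi>) - correlation h \<phi>"
    have apply_sum: "(\<Sum>k\<in>I. f k) y = (\<Sum>k\<in>I. apply_c0 (f k) y)" for f :: "nat \<Rightarrow> 'n c0" and I y
      by (induction I rule: infinite_finite_induct) (simp_all add: apply_c0_ops)
    have F_le: "cmod (correlation (F k) \<phi> y) \<le> c k" for k y
      using cmod_le_norm_c0[of "correlation (F k) \<phi>" y] norm_correlation_le[OF intF, of k \<phi>]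
        mult_mono[OF F1[of k] \<phi> c norm_ge_zero] by linarith
    have "norm ?\<psi> \<le> (3/4) ^ n"
    proof (rule norm_c0_le)
      fix y
      have "(\<lambda>k. correlation (F (k + n)) \<phi> y) sums
          (correlation h \<phi> y - (\<Sum>k<n. correlation (F k) \<phi> y))"
        using sums_split_initial_segment[OF h_sums] .
      then have "cmod (correlation h \<phi> y - (\<Sum>k<n. correlation (F k) \<phi> y)) \<le> (3/4) ^ n"
        by (rule norm_sums_le[OF _ c_tail]) (rule F_le)
      then show "cmod (?\<psi> y) \<le> (3/4) ^ n"
        by (simp add: apply_c0_ops apply_sum norm_minus_commute)
    qed
    moreover have "\<langle>\<phi>, H n \<nu> - h \<star> \<nu>\<rangle> = \<langle>?\<psi> + (3/4) ^ n *\<^sub>R \<phi>, \<nu>\<rangle>"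
      by (simp add: H_def pairing_ops pairing_sum_right pair pairing_convolution[OF h]
          pairing_diff_left pairing_add_left pairing_scaleR_left pairing_sum_left corrF
          pairing_scaleC_left c_def scaleR_conv_of_real)
    ultimately have "cmod \<langle>\<phi>, H n \<nu> - h \<star> \<nu>\<rangle> \<le> norm (?\<psi> + (3/4) ^ n *\<^sub>R \<phi>) * norm \<nu>"
      by (simp only: cmod_pairing_le)
    also have "norm (?\<psi> + (3/4) ^ n *\<^sub>R \<phi>) \<le> (3/4) ^ n + (3/4) ^ n * norm \<phi>"
      using norm_triangle_ineq[of ?\<psi> "(3/4) ^ n *\<^sub>R \<phi>"] \<open>norm ?\<psi> \<le> (3/4) ^ n\<close> by simp
    also have "\<dots> \<le> 2 * (3/4) ^ n" using \<phi> by (simp add: mult_left_le)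
    finally show "cmod \<langle>\<phi>, H n \<nu> - h \<star> \<nu>\<rangle> \<le> 2 * (3/4) ^ n * norm \<nu>"
      by (simp add: mult_right_mono)
  qed
  have "cmod \<langle>f, \<nu>\<rangle> \<le> 2 * M * norm (h \<star> \<nu>)" if f: "f \<in> L" for f \<nu>
  proof (rule LIMSEQ_le_const)
    have "(\<lambda>n. (3/4 :: real) ^ n) \<longlonglongrightarrow> 0" by (rule LIMSEQ_realpow_zero) auto
    then show "(\<lambda>n. 2 * M * (norm (h \<star> \<nu>) + 2 * (3/4) ^ n * norm \<nu>)) \<longlonglongrightarrow> 2 * M * norm (h \<star> \<nu>)"
      by (auto intro!: tendsto_eq_intros)
    have "cmod \<langle>f, \<nu>\<rangle> \<le> 2 * M * (norm (h \<star> \<nu>) + 2 * (3/4) ^ n * norm \<nu>)" for n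
    proof -
      have le: "norm (H n \<nu>) \<le> norm (h \<star> \<nu>) + 2 * (3/4) ^ n * norm \<nu>"
        using H_close[of n \<nu>] norm_triangle_sub[of "H n \<nu>" "h \<star> \<nu>"] by linarith
      have "M * (2 - (1/2) ^ n) \<le> M * 2" using M(1) by (intro mult_left_mono) auto
      from mult_mono[OF this le] have "M * (2 - (1/2) ^ n) * norm (H n \<nu>)
          \<le> M * 2 * (norm (h \<star> \<nu>) + 2 * (3/4) ^ n * norm \<nu>)"
        using M(1) by simp
      with bound_H[OF f, of \<nu> n] show ?thesis by (simp only: mult.commute[of M 2])
    qed
    then show "\<exists>N. \<forall>n\<ge>N. cmod \<langle>f, \<nu>\<rangle> \<le> 2 * M * (norm (h \<star> \<nu>) + 2 * (3/4) ^ n * norm \<nu>)" by blast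
  qed
  with h show thesis by (rule that)
qed


section \<open>Comparison of the topologies\<close>

lemma seminorm_p_seminorm:
  fixes g :: "'n::finite c0"
  assumes h: "integrable lborel h"
  shows "seminorm (p_seminorm g h)"
proof -
  have "h \<star> (g \<odot> (\<mu> + \<nu>)) = h \<star> (g \<odot> \<mu>) + h \<star> (g \<odot> \<nu>)" for \<mu> \<nu>
    by (rule cdual_eqI) (simp add: pairing_convolution_times[OF h] pairing_ops)
  moreover have "h \<star> (g \<odot> (a *\<^sub>C \<mu>)) = a *\<^sub>C (h \<star> (g \<odot> \<mu>))" for a \<mu>
    by (rule cdual_eqI) (simp add: pairing_convolution_times[OF h] pairing_ops)
  ultimately show ?thesis
    unfolding seminorm_def p_seminorm_def by (simp add: norm_triangle_ineq norm_scaleC)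
qed

text \<open>After factoring \<open>K \<subseteq> g \<cdot> L\<close>, the bound on \<open>L\<close> is applied to the measure \<open>g \<odot> \<nu>\<close>.\<close>
theorem compact_seminorm_le_p_seminorm:
  fixes K :: "'n::finite c0 set"
  assumes K: "compact K"
  obtains g h C where "integrable lborel h" "0 < C"
    "\<And>f \<nu>. f \<in> K \<Longrightarrow> cmod \<langle>f, \<nu>\<rangle> \<le> C * p_seminorm g h \<nu>"
proof -
  obtain g L where L: "compact L" and KL: "K \<subseteq> (\<lambda>f. g * f) ` L"
    by (rule compact_c0_factorization[OF K])
  obtain b where b: "\<And>f. f \<in> L \<Longrightarrow> norm f \<le> b"
    using compact_imp_bounded[OF L] bounded_iff by metis
  obtain h :: "real^'n \<Rightarrow> complex" where h: "integrable lborel h"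
    and le: "\<And>f \<nu>. f \<in> L \<Longrightarrow> cmod \<langle>f, \<nu>\<rangle> \<le> 2 * max 1 b * norm (h \<star> \<nu>)"
  proof (rule uniform_bound_by_one_convolution)
    show "uniformly_equicontinuous L" by (rule compact_imp_uniformly_equicontinuous[OF L])
    show "1 \<le> max 1 b" by simp
    show "norm f \<le> max 1 b" if "f \<in> L" for f using b[OF that] by simp
  qed blast
  show thesis
  proof (rule that[OF h])
    show "0 < 2 * max 1 b" by simp
    fix f \<nu> assume "f \<in> K"
    then obtain f' where f': "f' \<in> L" "f = g * f'" using KL by blast
    show "cmod \<langle>f, \<nu>\<rangle> \<le> 2 * max 1 b * p_seminorm g h \<nu>"
      using le[OF f'(1), of "g \<odot> \<nu>"] by (simp only: pairing_times_measure f'(2) p_seminorm_def)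
  qed
qed

text \<open>The condition \<open>p 0 = 0\<close> puts \<open>\<nu>\<close> into its own ball.\<close>

lemma openin_seminorm_topologyI:
  assumes "\<And>\<nu>. \<nu> \<in> U \<Longrightarrow> \<exists>p\<in>P. \<exists>e>0. p 0 = 0 \<and> {\<mu>. p (\<mu> - \<nu>) < e} \<subseteq> U"
  shows "openin (seminorm_topology P) U"
proof (subst openin_subopen, intro ballI)
  fix \<nu> assume "\<nu> \<in> U"
  then obtain p e where p: "p \<in> P" "0 < e" "p 0 = 0" "{\<mu>. p (\<mu> - \<nu>) < e} \<subseteq> U"
    using assms by blast
  have "openin (seminorm_topology P) {\<mu>. p (\<mu> - \<nu>) < e}"
    unfolding seminorm_topology_def by (rule topology_generated_by_Basis) (use p in blast)
  then show "\<exists>T. openin (seminorm_topology P) T \<and> \<nu> \<in> T \<and> T \<subseteq> U"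
    using p by (intro exI[of _ "{\<mu>. p (\<mu> - \<nu>) < e}"]) simp
qed

lemma openin_kappaI:
  assumes "\<And>\<nu>. \<nu> \<in> U \<Longrightarrow> \<exists>K e. compact K \<and> absolutely_convex K \<and> 0 < e \<and>
      {\<mu>. \<forall>x\<in>K. cmod (\<langle>x, \<mu>\<rangle> - \<langle>x, \<nu>\<rangle>) < e} \<subseteq> U"
  shows "openin kappa U"
proof (subst openin_subopen, intro ballI)
  fix \<nu> assume "\<nu> \<in> U"
  then obtain K e where K: "compact K" "absolutely_convex K" "0 < e"
      "{\<mu>. \<forall>x\<in>K. cmod (\<langle>x, \<mu>\<rangle> - \<langle>x, \<nu>\<rangle>) < e} \<subseteq> U"
    using assms by blast
  have "openin kappa {\<mu>. \<forall>x\<in>K. cmod (\<langle>x, \<mu>\<rangle> - \<langle>x, \<nu>\<rangle>) < e}"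
    unfolding kappa_def by (rule topology_generated_by_Basis) (use K in blast)
  then show "\<exists>T. openin kappa T \<and> \<nu> \<in> T \<and> T \<subseteq> U"
    using K by (intro exI[of _ "{\<mu>. \<forall>x\<in>K. cmod (\<langle>x, \<mu>\<rangle> - \<langle>x, \<nu>\<rangle>) < e}"]) simp
qed

lemma generated_topologies_eqI:
  assumes "\<And>U. U \<in> S \<Longrightarrow> openin (topology_generated_by T) U"
    and "\<And>U. U \<in> T \<Longrightarrow> openin (topology_generated_by S) U"
  shows "topology_generated_by S = topology_generated_by T"
proof -
  have *: "openin (topology_generated_by S) U"
    if "openin (topology_generated_by T) U" "\<And>U. U \<in> T \<Longrightarrow> openin (topology_generated_by S) U"
    for S T :: "'a set set" and U
  proof -
    have "generate_topology_on T U" using that(1) by (simp add: openin_topology_generated_by_iff)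
    then show ?thesis
    proof induction
      case (UN K)
      then show ?case by (intro openin_Union) blast
    qed (use that(2) in auto)
  qed
  show ?thesis unfolding topology_eq using * assms by blast
qed

theorem proposition18:
  shows "(\<forall>(g :: 'n::finite c0) h. integrable lborel h \<longrightarrow> seminorm (p_seminorm g h)) \<and>
    (kappa :: 'n integrable_measure topology) =
      seminorm_topology {p_seminorm g h | g h. integrable lborel h}"
proof (intro conjI allI impI)
  show "seminorm (p_seminorm g h)" if "integrable lborel h" for g :: "'n c0" and h
    using that by (rule seminorm_p_seminorm)
  let ?P = "{p_seminorm g h | (g :: 'n c0) h. integrable lborel h}"
  show "(kappa :: 'n integrable_measure topology) = seminorm_topology ?P"
    unfolding kappa_def seminorm_topology_def
  proof (rule generated_topologies_eqI; fold kappa_def seminorm_topology_def)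
    fix U assume "U \<in> {{\<nu>. \<forall>x\<in>K. cmod (\<langle>x, \<nu>\<rangle> - \<langle>x, \<mu>\<rangle>) < e} | (K :: 'n c0 set) \<mu> e.
        compact K \<and> absolutely_convex K \<and> 0 < e}"
    then obtain K :: "'n c0 set" and \<mu> e where K: "compact K" and "0 < e"
      and U: "U = {\<nu>. \<forall>x\<in>K. cmod (\<langle>x, \<nu>\<rangle> - \<langle>x, \<mu>\<rangle>) < e}" by blast
    obtain g h C where h: "integrable lborel h" and "0 < C"
      and le: "\<And>f \<nu>. f \<in> K \<Longrightarrow> cmod \<langle>f, \<nu>\<rangle> \<le> C * p_seminorm g h \<nu>"
      by (rule compact_seminorm_le_p_seminorm[OF K]) blast
    show "openin (seminorm_topology ?P) U"
    proof (rule openin_seminorm_topologyI)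
      fix \<nu> assume "\<nu> \<in> U"
      \<comment> \<open>The strict bound on the compact set \<open>K\<close> leaves a uniform margin \<open>r\<close>.\<close>
      have "\<exists>r>0. \<forall>x\<in>K. cmod (\<langle>x, \<nu>\<rangle> - \<langle>x, \<mu>\<rangle>) + r \<le> e"
      proof (cases "K = {}")
        case False
        have "continuous_on K (\<lambda>x. cmod (\<langle>x, \<nu>\<rangle> - \<langle>x, \<mu>\<rangle>))"
          by (intro continuous_intros linear_continuous_on bounded_linear_pairing)
        from continuous_attains_sup[OF K False this] obtain x0 where x0: "x0 \<in> K"
          "\<And>x. x \<in> K \<Longrightarrow> cmod (\<langle>x, \<nu>\<rangle> - \<langle>x, \<mu>\<rangle>) \<le> cmod (\<langle>x0, \<nu>\<rangle> - \<langle>x0, \<mu>\<rangle>)" by blast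
        have "cmod (\<langle>x0, \<nu>\<rangle> - \<langle>x0, \<mu>\<rangle>) < e" using \<open>\<nu> \<in> U\<close> x0(1) by (simp add: U)
        then show ?thesis
          using x0(2) by (intro exI[of _ "e - cmod (\<langle>x0, \<nu>\<rangle> - \<langle>x0, \<mu>\<rangle>)"]) auto
      qed (auto intro: exI[of _ 1])
      then obtain r where "0 < r" and r: "\<And>x. x \<in> K \<Longrightarrow> cmod (\<langle>x, \<nu>\<rangle> - \<langle>x, \<mu>\<rangle>) + r \<le> e" by blast
      have "\<xi> \<in> U" if \<xi>: "p_seminorm g h (\<xi> - \<nu>) < r / C" for \<xi>
        unfolding U
      proof (intro CollectI ballI)
        fix x assume x: "x \<in> K"
        have "cmod (\<langle>x, \<xi>\<rangle> - \<langle>x, \<nu>\<rangle>) \<le> C * p_seminorm g h (\<xi> - \<nu>)"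
          using le[OF x, of "\<xi> - \<nu>"] by (simp add: pairing_ops)
        also have "\<dots> < r" using \<xi> \<open>0 < C\<close> by (simp add: pos_less_divide_eq mult.commute)
        finally show "cmod (\<langle>x, \<xi>\<rangle> - \<langle>x, \<mu>\<rangle>) < e"
          using r[OF x] norm_triangle_ineq[of "\<langle>x, \<xi>\<rangle> - \<langle>x, \<nu>\<rangle>" "\<langle>x, \<nu>\<rangle> - \<langle>x, \<mu>\<rangle>"] by simp
      qed
      moreover have "p_seminorm g h 0 = 0"
      proof -
        have "h \<star> (g \<odot> 0) = 0" by (rule cdual_eqI) (simp add: pairing_convolution_times[OF h] pairing_ops)
        then show ?thesis by (simp add: p_seminorm_def)
      qed
      ultimately show "\<exists>p\<in>?P. \<exists>e>0. p 0 = 0 \<and> {\<xi>. p (\<xi> - \<nu>) < e} \<subseteq> U"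
        using h \<open>0 < r\<close> \<open>0 < C\<close>
        by (intro bexI[of _ "p_seminorm g h"] exI[of _ "r / C"]) auto
    qed
  next
    fix U assume "U \<in> insert UNIV {{\<nu>. p (\<nu> - \<mu>) < e} | p \<mu> e. p \<in> ?P \<and> 0 < e}"
    then consider "U = UNIV"
      | g h \<mu> e where "integrable lborel h" "U = {\<nu>. p_seminorm (g :: 'n c0) h (\<nu> - \<mu>) < e}"
      by blast
    then show "openin kappa U"
    proof cases
      case 1
      show ?thesis
        by (rule openin_kappaI, intro exI[of _ "{}"] exI[of _ 1]) (simp add: 1 absolutely_convex_def)
    next
      case (2 g h \<mu> e)
      obtain K where K: "compact K" "absolutely_convex K"
        and le: "\<And>\<mu> e. (\<And>f. f \<in> K \<Longrightarrow> cmod \<langle>f, \<mu>\<rangle> \<le> e) \<Longrightarrow> p_seminorm g h \<mu> \<le> e"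
        by (rule p_seminorm_le_sup_on_compact[OF 2(1)]) blast
      show ?thesis
      proof (rule openin_kappaI)
        fix \<nu> assume "\<nu> \<in> U"
        \<comment> \<open>Halved, because a pointwise strict bound on \<open>K\<close> gives only a weak bound on the seminorm.\<close>
        define r where "r = (e - p_seminorm g h (\<nu> - \<mu>)) / 2"
        have "0 < r" using \<open>\<nu> \<in> U\<close> by (simp add: 2(2) r_def)
        have "\<xi> \<in> U" if \<xi>: "\<forall>x\<in>K. cmod (\<langle>x, \<xi>\<rangle> - \<langle>x, \<nu>\<rangle>) < r" for \<xi>
        proof -
          have "p_seminorm g h (\<xi> - \<nu>) \<le> r"
            by (rule le) (use \<xi> in \<open>auto simp: pairing_ops intro: less_imp_le\<close>)
          moreover have "p_seminorm g h ((\<xi> - \<nu>) + (\<nu> - \<mu>))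
              \<le> p_seminorm g h (\<xi> - \<nu>) + p_seminorm g h (\<nu> - \<mu>)"
            using seminorm_p_seminorm[OF 2(1), of g] unfolding seminorm_def by blast
          ultimately show ?thesis using \<open>0 < r\<close> by (simp add: 2(2) r_def)
        qed
        then show "\<exists>K e. compact K \<and> absolutely_convex K \<and> 0 < e \<and>
            {\<xi>. \<forall>x\<in>K. cmod (\<langle>x, \<xi>\<rangle> - \<langle>x, \<nu>\<rangle>) < e} \<subseteq> U"
          using K \<open>0 < r\<close> by (intro exI[of _ K] exI[of _ r]) auto
      qed
    qed
  qed
qed

end
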